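(* Every natural number $n\in\mathbb{N}=\{0,1,2,\ldots\}$ can be written in each of the following five forms with $x,y,z\in\mathbb{Z}$: $$x^2+3y^2+t_z,\quad x^2+3t_y+t_z,\quad x^2+6t_y+t_z,\quad 3x^2+2t_y+t_z,\quad 4x^2+2t_y+t_z.$$ That is, for each of these five forms separately, there exist integers $x,y,z$ (depending on $n$ and the form) such that $n$ equals that expression.
   Context: For $x\in\mathbb{Z}$, $t_x$ denotes the triangular number $t_x=x(x+1)/2$. *)

theory Defs
  imports Main
begin

text \<open>Triangular number t_x = x(x+1)/2 for integer x (x(x+1) is always even, so div is exact).\<close>
definition tri :: "int \<Rightarrow> int" where
  "tri x = x * (x + 1) div 2"

end

theory Submission
  imports
    Defs
    "HOL-Number_Theory.Number_Theory"
    "HOL-Computational_Algebra.Squarefree"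
    "HOL-Library.Discrete_Functions"
begin

text \<open>
  Everything reduces to the three-square theorem. If 3 m is a sum of three squares, the
  signs can be chosen such that all three roots agree modulo 3, and then m = x^2 + 2 (u^2 +
  u v + v^2), that is, m = x^2 + 2 y^2 + 6 z^2. Hence this form represents 8 n + 1, 8 n + 3,
  8 n + 7 and 4 n + 2, and parity considerations turn these representations into the first
  four claims. For the fifth, write 8 n + 3 as a sum of three odd squares; after a choice of
  signs two of the roots agree modulo 8.

  For the three-square theorem let N be squarefree. One chooses a prime q = 1 (mod 4) with
  prescribed Legendre symbols at the prime divisors of N such that, for D = q or D = 2 q,
  the equation x^2 + D y^2 = N w^2 is solvable by a pigeonhole argument. As D is a sum of
  two rational squares, N is a sum of three rational squares, hence of three integral ones
  by the descent of Davenport and Cassels.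

  The prime q exists by Dirichlet's method, where only real characters are needed. To detect
  that chi(n) = chi(a) for all chi in a finite set F, expand the product of the factors 1 +
  chi(a) chi(n): the empty subset of F contributes the divergent sum of Lambda(n) / n, and
  every other subset contributes a real character, whose sum is bounded below. For
  nonprincipal characters this rests on L(1, chi) being nonzero, which is shown by Monsky's
  argument: the weights 1 / (n (1 - t)) - t^n / (1 - t^n) decrease in n, so L(1, chi) = 0
  would bound the Lambert series of chi as t tends to 1, although its coefficients are
  nonnegative and at least 1 at the squares.
\<close>

section \<open>Divisor sums\<close>

lemma sum_divisors_swap:
  fixes h :: "nat \<Rightarrow> nat \<Rightarrow> 'a :: comm_monoid_add"
  shows "(\<Sum>n=1..N. \<Sum>d | d dvd n. h d (n div d)) = (\<Sum>d=1..N. \<Sum>m=1..N div d. h d m)"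
proof -
  have quotient: "d * m \<le> N" if "m \<le> N div d" for d m
    using mult_le_mono2 [OF that, of d] by (rule order_trans) simp
  have divisor: "0 < d \<and> d \<le> N \<and> 0 < n div d" if "d dvd n" "0 < n" "n \<le> N" for d n
    using that dvd_imp_le [of d n] by (auto simp: div_greater_zero_iff intro: dvd_pos_nat)
  have "(\<Sum>(n, d)\<in>(SIGMA n:{1..N}. {d. d dvd n}). h d (n div d)) =
        (\<Sum>(d, m)\<in>(SIGMA d:{1..N}. {1..N div d}). h d m)"
    by (intro sum.reindex_bij_witness [of _ "\<lambda>(d, m). (d * m, d)" "\<lambda>(n, d). (d, n div d)"])
       (auto simp: Suc_le_eq div_le_mono quotient divisor)
  then show ?thesis by (simp add: sum.Sigma)
qed

lemma sum_divisors_mult_coprime: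
  fixes f :: "nat \<Rightarrow> 'a :: comm_semiring_1"
  assumes f_mult: "\<And>a b. f (a * b) = f a * f b" and "coprime m n"
  shows "(\<Sum>d | d dvd m * n. f d) = (\<Sum>d | d dvd m. f d) * (\<Sum>d | d dvd n. f d)"
proof -
  have "inj_on (\<lambda>(d, e). d * e) ({d. d dvd m} \<times> {e. e dvd n})"
  proof (rule inj_onI, clarify)
    fix d e d' e' assume "d * e = d' * e'" "d dvd m" "d' dvd m" "e dvd n" "e' dvd n"
    moreover from this have "coprime d e'" "coprime d' e"
      using \<open>coprime m n\<close> by (blast intro: coprime_divisors)+
    ultimately show "d = d' \<and> e = e'"
      using coprime_crossproduct_nat [of d e' d' e] by (simp add: mult.commute coprime_commute)
  qed
  moreover have "{d. d dvd m * n} = (\<lambda>(d, e). d * e) ` ({d. d dvd m} \<times> {e. e dvd n})"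
    by (auto elim!: dvd_productE intro: mult_dvd_mono)
  ultimately have "(\<Sum>d | d dvd m * n. f d) = (\<Sum>(d, e)\<in>{d. d dvd m} \<times> {e. e dvd n}. f d * f e)"
    by (simp add: sum.reindex case_prod_unfold f_mult)
  then show ?thesis by (simp add: sum_product sum.cartesian_product)
qed

lemma sum_divisors_prime_power:
  fixes f :: "nat \<Rightarrow> 'a :: comm_semiring_1"
  assumes f_mult: "\<And>a b. f (a * b) = f a * f b" and f_one: "f 1 = 1" and "prime p"
  shows "(\<Sum>d | d dvd p ^ k. f d) = (\<Sum>i\<le>k. f p ^ i)"
proof -
  have f_power: "f (p ^ i) = f p ^ i" for i
    by (induction i) (use f_mult f_one in auto)
  have "{d. d dvd p ^ k} = (\<lambda>i. p ^ i) ` {..k}"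
    using divides_primepow_nat [OF \<open>prime p\<close>] by auto
  moreover have "inj_on (\<lambda>i. p ^ i) {..k}"
    using prime_gt_1_nat [OF \<open>prime p\<close>] by (auto intro: inj_onI)
  ultimately show ?thesis by (simp add: sum.reindex f_power)
qed

lemma sum_divisors_prod_prime_powers:
  fixes f :: "nat \<Rightarrow> 'a :: comm_semiring_1"
  assumes f_mult: "\<And>a b. f (a * b) = f a * f b" and f_one: "f 1 = 1"
    and "finite P" "\<And>p. p \<in> P \<Longrightarrow> prime p"
  shows "(\<Sum>d | d dvd (\<Prod>p\<in>P. p ^ e p). f d) = (\<Prod>p\<in>P. \<Sum>i\<le>e p. f p ^ i)"
  using \<open>finite P\<close> assms(4)
proof (induction P rule: finite_induct)
  case (insert p P)
  have "coprime (p ^ e p) (\<Prod>q\<in>P. q ^ e q)"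
    using insert by (intro prod_coprime_right) (auto intro!: primes_coprime)
  then show ?case
    using insert by (simp add: sum_divisors_mult_coprime [of f] f_mult
        sum_divisors_prime_power [of f, OF f_mult f_one])
qed (use f_one in simp)

section \<open>Partial summation\<close>

lemma abs_sum_mult_antimono_le:
  fixes c f :: "nat \<Rightarrow> real"
  assumes bound: "\<And>b. \<bar>\<Sum>n\<in>{a..<b}. c n\<bar> \<le> B"
    and nonneg: "\<And>n. n \<ge> a \<Longrightarrow> f n \<ge> 0"
    and antimono: "\<And>n. n \<ge> a \<Longrightarrow> f (Suc n) \<le> f n"
  shows "\<bar>\<Sum>n\<in>{a..<b}. c n * f n\<bar> \<le> B * f a"
proof (cases "a \<le> b")
  case True
  define T where "T b = (\<Sum>n\<in>{a..<b}. c n)" for b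
  have by_parts: "(\<Sum>n\<in>{a..<b}. c n * f n) =
               T b * f b + (\<Sum>n\<in>{a..<b}. T (Suc n) * (f n - f (Suc n)))"
    using True
    by (induction b rule: dec_induct) (auto simp: T_def algebra_simps)
  have "\<bar>\<Sum>n\<in>{a..<b}. T (Suc n) * (f n - f (Suc n))\<bar> \<le> (\<Sum>n\<in>{a..<b}. B * (f n - f (Suc n)))"
  proof (intro sum_abs [THEN order_trans] sum_mono)
    fix n assume "n \<in> {a..<b}"
    then show "\<bar>T (Suc n) * (f n - f (Suc n))\<bar> \<le> B * (f n - f (Suc n))"
      using bound [of "Suc n"] antimono [of n] unfolding T_def abs_mult
      by (intro mult_mono) auto
  qed
  also have "\<dots> = B * (f a - f b)"
    using True
    by (simp add: sum_distrib_left [symmetric] sum_Suc_diff' [of a b "\<lambda>n. - f n", simplified])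
  finally have "\<bar>\<Sum>n\<in>{a..<b}. T (Suc n) * (f n - f (Suc n))\<bar> \<le> B * (f a - f b)" .
  moreover have "\<bar>T b * f b\<bar> \<le> B * f b"
    using bound [of b] nonneg [OF True] by (auto simp: T_def abs_mult intro!: mult_right_mono)
  ultimately show ?thesis
    unfolding by_parts by (simp add: algebra_simps)
next
  case False
  have "B \<ge> 0" using bound [of a] by simp
  with False show ?thesis using nonneg [of a] by simp
qed

context
  fixes c f :: "nat \<Rightarrow> real" and a :: nat and B :: real
  assumes bound: "\<And>a b. \<bar>\<Sum>n\<in>{a..<b}. c n\<bar> \<le> B"
    and nonneg: "\<And>n. n \<ge> a \<Longrightarrow> f n \<ge> 0"
    and antimono: "\<And>n. n \<ge> a \<Longrightarrow> f (Suc n) \<le> f n"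
    and to_0: "f \<longlonglongrightarrow> 0"
begin

lemma summable_Dirichlet_test: "summable (\<lambda>n. c n * f n)"
proof (rule summable_Cauchy')
  show "(\<lambda>m. B * f m) \<longlonglongrightarrow> 0" using tendsto_mult_right_zero [OF to_0] .
  show "\<forall>\<^sub>F m in sequentially. \<forall>n\<ge>m. norm (\<Sum>k\<in>{m..<n}. c k * f k) \<le> B * f m"
    using eventually_ge_at_top [of a]
    by eventually_elim (use abs_sum_mult_antimono_le bound nonneg antimono in simp)
qed

lemma Dirichlet_test_remainder:
  assumes "k \<ge> a"
  shows "\<bar>(\<Sum>n<k. c n * f n) - (\<Sum>n. c n * f n)\<bar> \<le> B * f k"
proof (rule Lim_bounded)
  let ?s = "\<lambda>m. \<Sum>n<m. c n * f n"
  show "(\<lambda>m. \<bar>?s k - ?s m\<bar>) \<longlonglongrightarrow> \<bar>?s k - (\<Sum>n. c n * f n)\<bar>"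
    by (intro tendsto_intros summable_LIMSEQ summable_Dirichlet_test)
  show "\<forall>m\<ge>k. \<bar>?s k - ?s m\<bar> \<le> B * f k"
  proof (intro allI impI)
    fix m assume "m \<ge> k"
    then have "?s k - ?s m = - (\<Sum>n\<in>{k..<m}. c n * f n)"
      using sum.atLeastLessThan_concat [of 0 k m "\<lambda>n. c n * f n"] by (simp add: lessThan_atLeast0)
    then show "\<bar>?s k - ?s m\<bar> \<le> B * f k"
      using abs_sum_mult_antimono_le [where a = k and b = m] bound nonneg antimono assms by simp
  qed
qed

end

section \<open>The von Mangoldt function\<close>

lemma ln_fact_eq_sum_mangoldt:
  assumes "k \<le> N"
  shows "ln (fact k :: real) = (\<Sum>d=1..N. mangoldt d * real (k div d))"
proof -
  have "ln (fact k :: real) = (\<Sum>n=1..k. ln (real n))"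
    by (induction k) (auto simp: ln_mult simp del: of_nat_Suc)
  also have "\<dots> = (\<Sum>n=1..k. \<Sum>d | d dvd n. mangoldt d)"
    by (intro sum.cong refl) (auto simp: mangoldt_sum)
  also have "\<dots> = (\<Sum>d=1..k. mangoldt d * real (k div d))"
    using sum_divisors_swap [of "\<lambda>d _. mangoldt d :: real" k] by (simp add: mult.commute)
  also have "\<dots> = (\<Sum>d=1..N. mangoldt d * real (k div d))"
    using assms by (intro sum.mono_neutral_left) auto
  finally show ?thesis .
qed

lemma ln_fact_ge: "real n * ln (real n) - real n \<le> ln (fact n)"
proof (induction n)
  case (Suc n)
  have "real n * (ln (real (Suc n)) - ln (real n)) \<le> 1"
    using ln_diff_le [of "real (Suc n)" "real n"] by (cases "n = 0") (auto simp: field_simps)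
  moreover have "ln (fact (Suc n) :: real) = ln (real (Suc n)) + ln (fact n)"
    by (simp add: ln_mult del: of_nat_Suc)
  ultimately show ?case using Suc by (simp add: algebra_simps)
qed simp

lemma sum_mangoldt_div_ge:
  assumes "N > 0"
  shows "ln (real N) - 1 \<le> (\<Sum>d=1..N. mangoldt d / real d)"
proof -
  have "real N * ln (real N) - real N \<le> ln (fact N)"
    by (rule ln_fact_ge)
  also have "ln (fact N :: real) \<le> (\<Sum>d=1..N. mangoldt d * (real N / real d))"
    unfolding ln_fact_eq_sum_mangoldt [OF order_refl]
    by (intro sum_mono mult_left_mono mangoldt_nonneg of_nat_div_le_of_nat)
  also have "\<dots> = real N * (\<Sum>d=1..N. mangoldt d / real d)"
    by (simp add: sum_distrib_left mult_ac)
  finally have "real N * (ln (real N) - 1) \<le> real N * (\<Sum>d=1..N. mangoldt d / real d)"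
    by (simp add: algebra_simps)
  then show ?thesis using assms by simp
qed

definition chebyshev_psi :: "nat \<Rightarrow> real" where
  "chebyshev_psi n = (\<Sum>d=1..n. mangoldt d)"

lemma chebyshev_psi_mono: "m \<le> n \<Longrightarrow> chebyshev_psi m \<le> chebyshev_psi n"
  unfolding chebyshev_psi_def by (intro sum_mono2) (auto simp: mangoldt_nonneg)

lemma ln_central_binomial_eq_sum_mangoldt:
  "ln (real (2 * n choose n)) = (\<Sum>d=1..2*n. mangoldt d * (real (2 * n div d) - 2 * real (n div d)))"
proof -
  have "(2 * n choose n) * (fact n * fact n) = fact (2 * n)"
    using binomial_fact_lemma [of n "2 * n"] by (simp add: mult_ac)
  then have "real (2 * n choose n) * (fact n * fact n) = fact (2 * n)"
    by (metis of_nat_fact of_nat_mult)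
  then have "ln (real (2 * n choose n) * (fact n * fact n)) = ln (fact (2 * n))"
    by (simp only:)
  then have "ln (real (2 * n choose n)) = ln (fact (2 * n)) - 2 * ln (fact n)"
    by (simp add: ln_mult_pos)
  also have "\<dots> = (\<Sum>d=1..2*n. mangoldt d * (real (2 * n div d) - 2 * real (n div d)))"
    by (simp add: ln_fact_eq_sum_mangoldt [of _ "2 * n"] algebra_simps sum_subtractf sum_distrib_left)
  finally show ?thesis .
qed

lemma chebyshev_psi_double: "chebyshev_psi (2 * n) \<le> chebyshev_psi n + real n * ln 4"
proof -
  have "chebyshev_psi (2 * n) - chebyshev_psi n = (\<Sum>d=n+1..2*n. mangoldt d)"
    using sum.ub_add_nat [of 1 n "mangoldt :: nat \<Rightarrow> real" n]
    by (simp add: chebyshev_psi_def mult_2)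
  also have "\<dots> \<le> (\<Sum>d=n+1..2*n. mangoldt d * (real (2 * n div d) - 2 * real (n div d)))"
  proof (intro sum_mono)
    fix d assume "d \<in> {n+1..2*n}"
    then have "n div d = 0" "2 * n div d \<ge> 1" by (auto simp: less_eq_div_iff_mult_less_eq)
    then have "1 \<le> real (2 * n div d) - 2 * real (n div d)" by simp
    from mult_left_mono [OF this mangoldt_nonneg [of d]]
    show "mangoldt d \<le> mangoldt d * (real (2 * n div d) - 2 * real (n div d))" by simp
  qed
  also have "\<dots> \<le> ln (real (2 * n choose n))"
    unfolding ln_central_binomial_eq_sum_mangoldt
  proof (intro sum_mono2 mult_nonneg_nonneg mangoldt_nonneg)
    fix d
    have "2 * (n div d) \<le> 2 * n div d"
      by (cases "d = 0") (auto simp: less_eq_div_iff_mult_less_eq)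
    then have "real (2 * (n div d)) \<le> real (2 * n div d)" by (rule of_nat_mono)
    then show "0 \<le> real (2 * n div d) - 2 * real (n div d)" by simp
  qed auto
  also have "\<dots> \<le> ln (real (2 ^ (2 * n)))"
    using binomial_le_pow2 [of "2 * n" n] by (simp add: ln_mono flip: of_nat_power)
  also have "\<dots> = real n * ln 4" by (simp add: power_mult ln_realpow)
  finally show ?thesis by simp
qed

lemma chebyshev_psi_le: "chebyshev_psi n \<le> 2 * ln 4 * real n"
proof (induction n rule: less_induct)
  case (less n)
  show ?case
  proof (cases "n \<ge> 2")
    case True
    define m where "m = (n + 1) div 2"
    have m_bounds: "m < n" "n \<le> 2 * m" "3 * m \<le> 2 * n"
      unfolding m_def using True by presburger+
    have "chebyshev_psi n \<le> chebyshev_psi (2 * m)"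
      using m_bounds(2) by (rule chebyshev_psi_mono)
    also have "\<dots> \<le> chebyshev_psi m + real m * ln 4" by (rule chebyshev_psi_double)
    also have "\<dots> \<le> ln 4 * real (3 * m)"
      using less.IH [OF m_bounds(1)] by (simp add: algebra_simps)
    also have "\<dots> \<le> ln 4 * real (2 * n)"
      using m_bounds(3) by (intro mult_left_mono of_nat_mono) auto
    finally show ?thesis by simp
  next
    case False
    then have "n = 0 \<or> n = 1" by auto
    then show ?thesis by (auto simp: chebyshev_psi_def)
  qed
qed

lemma summable_ln_div_square: "summable (\<lambda>n. ln (real n) / (real n)\<^sup>2)"
proof -
  define g where "g n = ln (real n) / real n + 2 / real n" for n
  have "g \<longlonglongrightarrow> 0"
    unfolding g_def
    using tendsto_add [OF filterlim_compose [OF ln_x_over_x_tendsto_0 filterlim_real_sequentially]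
        lim_const_over_n [of 2]] by simp
  then have "summable (\<lambda>n. g n - g (Suc n))" by (rule telescope_summable')
  then have "summable (\<lambda>n. ln (real (Suc n)) / (real (Suc n))\<^sup>2)"
  proof (rule summable_comparison_test' [where N = 1])
    fix n :: nat assume n_ge_1: "n \<ge> 1"
    define x y where "x = real n" and "y = real (Suc n)"
    have successive: "x \<ge> 1" "y = x + 1" using n_ge_1 by (simp_all add: x_def y_def)
    have ln_diff: "ln y - ln x \<le> 1 / x"
      using ln_diff_le [of y x] successive by simp
    also have "1 / x \<le> 1" using successive by simp
    finally have "ln y - ln x \<le> 1" .
    moreover have "x * (ln y - ln x) \<le> 1" using ln_diff successive by (simp add: field_simps)
    moreover have "0 \<le> ln x" using successive by simp
    ultimately have "0 \<le> ln x + 2 - x * (ln y - ln x)" "ln y \<le> ln x + 2 - x * (ln y - ln x)"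
      by linarith+
    then have "ln y / y\<^sup>2 \<le> (ln x + 2 - x * (ln y - ln x)) / (x * y)"
      using successive by (intro frac_le) (simp_all add: power2_eq_square)
    also have "ln x + 2 - x * (ln y - ln x) = (ln x + 2) * y - (ln y + 2) * x"
      using successive by (simp add: algebra_simps)
    also have "\<dots> / (x * y) = (ln x + 2) / x - (ln y + 2) / y"
      using successive by (simp only: diff_frac_eq)
    also have "\<dots> = g n - g (Suc n)"
      by (simp add: g_def x_def y_def add_divide_distrib)
    finally have "ln y / y\<^sup>2 \<le> g n - g (Suc n)" .
    then show "norm (ln (real (Suc n)) / (real (Suc n))\<^sup>2) \<le> g n - g (Suc n)"
      using successive by (simp add: x_def y_def)
  qed
  then show ?thesis by (subst (asm) summable_Suc_iff)
qed

lemma summable_of_bool_Un: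
  fixes f :: "nat \<Rightarrow> real"
  assumes "\<And>n. f n \<ge> 0"
    and "summable (\<lambda>n. of_bool (n \<in> A) * f n)" "summable (\<lambda>n. of_bool (n \<in> B) * f n)"
  shows "summable (\<lambda>n. of_bool (n \<in> A \<union> B) * f n)"
  using summable_add [OF assms(2,3)]
  by (rule summable_comparison_test') (use assms(1) in auto)

lemma summable_mangoldt_squares:
  "summable (\<lambda>n. of_bool (n \<in> range (\<lambda>m. m\<^sup>2)) * (mangoldt n / real n))"
proof -
  have "summable (\<lambda>m. 2 * (ln (real m) / (real m)\<^sup>2))"
    by (intro summable_mult summable_ln_div_square)
  then have "summable (\<lambda>m. mangoldt (m\<^sup>2) / real (m\<^sup>2))"
  proof (rule summable_comparison_test' [where N = 1])
    fix m :: nat assume "m \<ge> 1"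
    then have "mangoldt (m\<^sup>2) \<le> 2 * ln (real m)"
      using mangoldt_le [of "m\<^sup>2"] by (simp add: ln_realpow)
    then show "norm (mangoldt (m\<^sup>2) / real (m\<^sup>2) :: real) \<le> 2 * (ln (real m) / (real m)\<^sup>2)"
      by (simp add: divide_right_mono)
  qed
  moreover have "strict_mono (\<lambda>m::nat. m\<^sup>2)" by (intro strict_monoI power_strict_mono) auto
  ultimately show ?thesis
    using summable_mono_reindex [of "\<lambda>m. m\<^sup>2"
        "\<lambda>n. of_bool (n \<in> range (\<lambda>m. m\<^sup>2)) * (mangoldt n / real n)"]
    by simp
qed

lemma summable_mangoldt_prime_powers:
  assumes "finite P" "\<And>p. p \<in> P \<Longrightarrow> prime p"
  shows "summable (\<lambda>n. of_bool (n \<in> (\<Union>p\<in>P. range (\<lambda>k. p ^ k))) * (mangoldt n / real n))"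
  using assms
proof (induction P rule: finite_induct)
  case (insert p P)
  have p_gt_1: "p > 1" using insert.prems [of p] by (simp add: prime_gt_Suc_0_nat)
  have "summable (\<lambda>k. ln (real p) * (1 / real p) ^ k)"
    using p_gt_1 by (intro summable_mult summable_geometric) auto
  then have "summable (\<lambda>k. mangoldt (p ^ k) / real (p ^ k))"
  proof (rule summable_comparison_test' [where N = 1])
    fix k :: nat assume "k \<ge> 1"
    then show "norm (mangoldt (p ^ k) / real (p ^ k) :: real) \<le> ln (real p) * (1 / real p) ^ k"
      using insert.prems p_gt_1 by (simp add: power_divide)
  qed
  moreover have "strict_mono (\<lambda>k. p ^ k)"
    using p_gt_1 by (intro strict_monoI power_strict_increasing)
  ultimately have "summable (\<lambda>n. of_bool (n \<in> range (\<lambda>k. p ^ k)) * (mangoldt n / real n))"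
    using summable_mono_reindex [of "\<lambda>k. p ^ k"
        "\<lambda>n. of_bool (n \<in> range (\<lambda>k. p ^ k)) * (mangoldt n / real n)"]
    by simp
  then show ?case
    using insert by (simp only: UN_insert) (intro summable_of_bool_Un, auto simp: mangoldt_nonneg)
qed simp

section \<open>Real characters\<close>

locale real_character =
  fixes \<chi> :: "nat \<Rightarrow> real" and M :: nat
  assumes modulus_pos: "M > 0"
    and periodic: "\<chi> (n + M) = \<chi> n"
    and mult: "\<chi> (m * n) = \<chi> m * \<chi> n"
    and value_if_coprime: "coprime n M \<Longrightarrow> \<chi> n \<in> {-1, 1}"
    and eq_0_if_not_coprime: "\<not> coprime n M \<Longrightarrow> \<chi> n = 0"
begin

lemma value_cases: "\<chi> n \<in> {-1, 0, 1}"
  using value_if_coprime eq_0_if_not_coprime by blast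

lemma abs_le_1: "\<bar>\<chi> n\<bar> \<le> 1"
  using value_cases [of n] by auto

lemma one: "\<chi> 1 = 1"
  using mult [of 1 1] value_if_coprime [of 1] by auto

lemma power: "\<chi> (n ^ k) = \<chi> n ^ k"
  by (induction k) (use mult one in auto)

lemma mod_modulus: "\<chi> (n mod M) = \<chi> n"
proof -
  have "\<chi> (m + M * k) = \<chi> m" for m k
    by (induction k) (use periodic in \<open>auto simp: algebra_simps\<close>,
        metis periodic add.assoc add.commute)
  then show ?thesis by (metis mod_mult_div_eq)
qed

lemma nonzero_at_large_prime:
  assumes "prime p" "p > M" shows "\<chi> p \<noteq> 0"
proof -
  have "coprime p M"
    using assms modulus_pos by (intro prime_imp_coprime) (auto dest: dvd_imp_le)
  then show ?thesis using value_if_coprime [of p] by auto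
qed

definition divisor_sum :: "nat \<Rightarrow> real" where
  "divisor_sum n = (\<Sum>d | d dvd n. \<chi> d)"

lemma divisor_sum_nonneg:
  assumes "n > 0" shows "divisor_sum n \<ge> 0"
proof -
  have "(\<Sum>i\<le>k. (-1) ^ i) = (if even k then 1 else 0 :: real)" for k
    by (induction k) auto
  then have "(\<Sum>i\<le>k. \<chi> p ^ i) \<ge> 0" for p k
    using value_cases [of p] by (auto simp: sum_nonneg)
  then have "0 \<le> (\<Prod>p\<in>prime_factors n. \<Sum>i\<le>multiplicity p n. \<chi> p ^ i)"
    by (intro prod_nonneg) auto
  also have "\<dots> = divisor_sum (\<Prod>p\<in>prime_factors n. p ^ multiplicity p n)"
    unfolding divisor_sum_def using mult one
    by (intro sum_divisors_prod_prime_powers [symmetric]) auto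
  finally show ?thesis using assms by (simp flip: prime_factorization_nat)
qed

lemma divisor_sum_square_ge_1:
  assumes "n > 0" shows "divisor_sum (n\<^sup>2) \<ge> 1"
proof -
  have "(\<Sum>i\<le>2 * k. (-1) ^ i) = (1 :: real)" for k
    by (induction k) auto
  then have "(\<Sum>i\<le>2 * k. \<chi> p ^ i) \<ge> 1" for p k
    using value_cases [of p] by (auto simp: power_0_left)
  then have "1 \<le> (\<Prod>p\<in>prime_factors n. \<Sum>i\<le>2 * multiplicity p n. \<chi> p ^ i)"
    by (intro prod_ge_1) auto
  also have "\<dots> = divisor_sum (\<Prod>p\<in>prime_factors n. p ^ (2 * multiplicity p n))"
    unfolding divisor_sum_def using mult one
    by (intro sum_divisors_prod_prime_powers [symmetric]) auto
  also have "(\<Prod>p\<in>prime_factors n. p ^ (2 * multiplicity p n)) =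
      (\<Prod>p\<in>prime_factors n. p ^ multiplicity p n)\<^sup>2"
    by (simp add: power_even_eq flip: prod_power_distrib)
  also have "(\<Prod>p\<in>prime_factors n. p ^ multiplicity p n) = n"
    using assms by (rule prime_factorization_nat [symmetric])
  finally show ?thesis .
qed

end

locale nonprincipal_real_character = real_character +
  assumes nonprincipal: "\<exists>a. \<chi> a = -1"
begin

lemma sum_period: "(\<Sum>n<M. \<chi> n) = 0"
proof -
  obtain a where a_value: "\<chi> a = -1" using nonprincipal by blast
  then have "coprime a M" using eq_0_if_not_coprime by fastforce
  have "inj_on (\<lambda>n. a * n mod M) {..<M}"
  proof (rule inj_onI)
    fix x y assume "x \<in> {..<M}" "y \<in> {..<M}" "a * x mod M = a * y mod M"
    then show "x = y"
      using cong_mult_lcancel_nat [OF \<open>coprime a M\<close>, of x y] by (simp add: cong_def)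
  qed
  moreover from this have "(\<lambda>n. a * n mod M) ` {..<M} = {..<M}"
    using modulus_pos by (intro endo_inj_surj) auto
  ultimately have "(\<Sum>n<M. \<chi> n) = (\<Sum>n<M. \<chi> (a * n mod M))"
    using sum.reindex [of "\<lambda>n. a * n mod M" "{..<M}" \<chi>] by simp
  also have "\<dots> = - (\<Sum>n<M. \<chi> n)"
    by (simp add: mod_modulus mult a_value sum_negf)
  finally show ?thesis by simp
qed

lemma abs_sum_le: "\<bar>\<Sum>n\<in>{a..<b}. \<chi> n\<bar> \<le> 2 * real M"
proof -
  define S where "S n = (\<Sum>k<n. \<chi> k)" for n
  have "S (n + M) = S n" for n
    by (induction n) (auto simp: S_def sum_period periodic)
  then have "S (n + M * k) = S n" for n k
    by (induction k) (auto simp: algebra_simps, metis add.assoc add.commute)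
  then have "S n = S (n mod M)" for n
    by (metis mod_mult_div_eq)
  moreover have "\<bar>S (n mod M)\<bar> \<le> real M" for n
  proof -
    have "\<bar>S (n mod M)\<bar> \<le> (\<Sum>k<n mod M. 1)"
      unfolding S_def by (intro sum_abs [THEN order_trans] sum_mono abs_le_1)
    also have "\<dots> \<le> real M" using modulus_pos by (simp add: less_imp_le)
    finally show ?thesis .
  qed
  ultimately have S_le: "\<bar>S n\<bar> \<le> real M" for n by metis
  show ?thesis
  proof (cases "a \<le> b")
    case True
    then have "(\<Sum>n\<in>{a..<b}. \<chi> n) = S b - S a"
      unfolding S_def by (metis sum_diff_nat_ivl atLeast0LessThan zero_le)
    with S_le [of a] S_le [of b] show ?thesis by linarith
  qed auto
qed

end

section \<open>Non-vanishing of L(1)\<close>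

lemma sum_even_powers_ge:
  fixes t :: real
  shows "real n * t ^ (n - 1) \<le> (\<Sum>i<n. t ^ (2 * i))"
proof -
  have "2 * (real n * t ^ (n - 1)) = (\<Sum>i<n. 2 * t ^ i * t ^ (n - Suc i))"
    by (simp add: mult.assoc flip: power_add)
  also have "\<dots> \<le> (\<Sum>i<n. (t ^ i)\<^sup>2 + (t ^ (n - Suc i))\<^sup>2)"
    by (intro sum_mono sum_squares_bound)
  also have "\<dots> = 2 * (\<Sum>i<n. (t ^ i)\<^sup>2)"
    by (simp add: sum.distrib sum.nat_diff_reindex [of "\<lambda>i. (t ^ i)\<^sup>2"])
  finally show ?thesis by (simp add: mult.commute flip: power_mult)
qed

lemma power_le_mult_geometric_sums:
  fixes t :: real
  assumes "0 \<le> t" "t \<le> 1"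
  shows "real n * real (Suc n) * t ^ n \<le> (\<Sum>i<n. t ^ i) * (\<Sum>i<Suc n. t ^ i)"
proof (cases "n = 0")
  case False
  define w where "w = sqrt t"
  have w: "0 \<le> w" "w \<le> 1" "t = w\<^sup>2" using assms by (auto simp: w_def)
  have "t ^ n = w ^ (2 * n)" unfolding w(3) by (simp add: power_mult)
  also have "\<dots> \<le> w ^ (n - 1 + n)"
    using w by (intro power_decreasing) auto
  finally have "real n * real (Suc n) * t ^ n \<le> real n * real (Suc n) * w ^ (n - 1 + n)"
    by (intro mult_left_mono) auto
  also have "\<dots> = (real n * w ^ (n - 1)) * (real (Suc n) * w ^ (Suc n - 1))"
    by (simp add: power_add)
  also have "\<dots> \<le> (\<Sum>i<n. w ^ (2 * i)) * (\<Sum>i<Suc n. w ^ (2 * i))"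
    using w by (intro mult_mono sum_even_powers_ge) (auto intro: sum_nonneg)
  finally show ?thesis by (simp add: w(3) power_mult)
qed simp

definition lambert_weight :: "real \<Rightarrow> nat \<Rightarrow> real" where
  "lambert_weight t n = 1 / (real n * (1 - t)) - t ^ n / (1 - t ^ n)"

context
  fixes t :: real
  assumes t_bounds: "0 < t" "t < 1"
begin

lemma geometric_sum_pos: "n > 0 \<Longrightarrow> 0 < (\<Sum>i<n. t ^ i)"
  using t_bounds by (intro sum_pos) auto

lemma lambert_weight_eq:
  "lambert_weight t n = (1 / real n - t ^ n / (\<Sum>i<n. t ^ i)) / (1 - t)"
  by (simp add: lambert_weight_def one_diff_power_eq diff_divide_distrib mult.commute)

lemma lambert_weight_nonneg:
  assumes "n > 0" shows "lambert_weight t n \<ge> 0"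
proof -
  have "real n * t ^ n = (\<Sum>i<n. t ^ n)" by simp
  also have "\<dots> \<le> (\<Sum>i<n. t ^ i)" using t_bounds by (intro sum_mono power_decreasing) auto
  finally show ?thesis
    using assms t_bounds geometric_sum_pos [of n] by (simp add: lambert_weight_eq field_simps)
qed

lemma lambert_weight_antimono:
  assumes "n > 0" shows "lambert_weight t (Suc n) \<le> lambert_weight t n"
proof -
  define s where "s n = (\<Sum>i<n. t ^ i)" for n
  have s_pos: "s n > 0" "s (Suc n) > 0"
    using assms by (simp_all add: s_def geometric_sum_pos del: sum.lessThan_Suc)
  have s_Suc: "s (Suc n) = 1 + t * s n"
    unfolding s_def by (subst sum.lessThan_Suc_shift) (simp add: sum_distrib_left)
  have "t ^ n / s n - t ^ Suc n / s (Suc n) = t ^ n * (s (Suc n) - t * s n) / (s n * s (Suc n))"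
    using s_pos by (simp add: divide_simps algebra_simps)
  also have "\<dots> = t ^ n / (s n * s (Suc n))" by (simp add: s_Suc)
  also have "\<dots> \<le> 1 / (real n * real (Suc n))"
    using power_le_mult_geometric_sums [of t n] t_bounds s_pos assms
    by (simp add: s_def field_simps del: sum.lessThan_Suc of_nat_Suc)
  also have "\<dots> = 1 / real n - 1 / real (Suc n)"
    using assms by (simp add: field_simps)
  finally show ?thesis
    using assms t_bounds
    by (simp add: lambert_weight_eq s_def divide_right_mono del: sum.lessThan_Suc)
qed

lemma lambert_weight_1: "lambert_weight t 1 = 1"
  using t_bounds by (simp add: lambert_weight_def field_simps)

end

context real_character
begin

lemma sum_divisor_sum_power_le:
  assumes "0 < t" "t < 1"
  shows "(\<Sum>k=1..N. divisor_sum k * t ^ k) \<le>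
           (\<Sum>n=1..N. \<chi> n * (t ^ n / (1 - t ^ n))) + real N * t ^ N / (1 - t)"
proof -
  have geometric: "(\<Sum>m=1..q. x ^ m) = x / (1 - x) - x ^ Suc q / (1 - x)"
    if "x \<noteq> 1" for x :: real and q
    using that by (cases "q = 0") (simp_all add: sum_gp diff_divide_distrib)
  have "(\<Sum>k=1..N. divisor_sum k * t ^ k) = (\<Sum>k=1..N. \<Sum>d | d dvd k. \<chi> d * (t ^ d) ^ (k div d))"
    unfolding divisor_sum_def sum_distrib_right
    by (intro sum.cong refl) (simp flip: power_mult)
  also have "\<dots> = (\<Sum>d=1..N. \<chi> d * (\<Sum>m=1..N div d. (t ^ d) ^ m))"
    unfolding sum_distrib_left by (rule sum_divisors_swap [of "\<lambda>d m. \<chi> d * (t ^ d) ^ m"])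
  also have "\<dots> \<le> (\<Sum>d=1..N. \<chi> d * (t ^ d / (1 - t ^ d)) + t ^ N / (1 - t))"
  proof (intro sum_mono)
    fix d assume d_range: "d \<in> {1..N}"
    define r where "r = (t ^ d) ^ Suc (N div d) / (1 - t ^ d)"
    have t_power: "t ^ d \<le> t" using d_range assms power_decreasing [of 1 d t] by simp
    have "N \<le> d * Suc (N div d)"
      using d_range dividend_less_times_div [of d N] by simp
    then have "(t ^ d) ^ Suc (N div d) \<le> t ^ N"
      using assms unfolding power_mult [symmetric] by (intro power_decreasing) auto
    then have "r \<le> t ^ N / (1 - t)"
      unfolding r_def using assms t_power by (intro frac_le) auto
    moreover have "- \<chi> d * r \<le> r"
      using value_cases [of d] assms t_power by (auto simp: r_def)
    moreover have "(\<Sum>m=1..N div d. (t ^ d) ^ m) = t ^ d / (1 - t ^ d) - r"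
      using assms t_power by (simp only: geometric r_def)
    ultimately show "\<chi> d * (\<Sum>m=1..N div d. (t ^ d) ^ m) \<le>
        \<chi> d * (t ^ d / (1 - t ^ d)) + t ^ N / (1 - t)"
      by (simp add: right_diff_distrib)
  qed
  finally show ?thesis by (simp add: sum.distrib)
qed

lemma real_le_sum_divisor_sum: "real n \<le> (\<Sum>k=1..n\<^sup>2. divisor_sum k)"
proof -
  have "real n \<le> (\<Sum>m=1..n. divisor_sum (m\<^sup>2))"
    using sum_mono [of "{1..n}" "\<lambda>_. 1" "\<lambda>m. divisor_sum (m\<^sup>2)"] divisor_sum_square_ge_1 by simp
  also have "\<dots> = (\<Sum>k\<in>(\<lambda>m. m\<^sup>2) ` {1..n}. divisor_sum k)"
    by (subst sum.reindex) (auto intro: inj_onI)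
  also have "\<dots> \<le> (\<Sum>k=1..n\<^sup>2. divisor_sum k)"
    by (intro sum_mono2 divisor_sum_nonneg) (auto simp: power_mono)
  finally show ?thesis .
qed

end

context nonprincipal_real_character
begin

definition L_one :: real where  \<comment> \<open>the term for n = 0 vanishes since 1 / 0 = 0\<close>
  "L_one = (\<Sum>n. \<chi> n * (1 / real n))"

lemma L_one_remainder:
  "\<bar>(\<Sum>n=1..N. \<chi> n * (1 / real n)) - L_one\<bar> \<le> 2 * real M * (1 / real (Suc N))"
proof -
  have "(\<Sum>n=1..N. \<chi> n * (1 / real n)) = (\<Sum>n<Suc N. \<chi> n * (1 / real n))"
    by (intro sum.mono_neutral_left) auto
  then show ?thesis
    using Dirichlet_test_remainder [of \<chi> "2 * real M" 1 "\<lambda>n. 1 / real n" "Suc N"]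
      abs_sum_le lim_1_over_n
    by (simp add: L_one_def frac_le)
qed

lemma sum_lambert_le_if_L_one_eq_0:
  assumes "L_one = 0" "0 < t" "t < 1"
  shows "(\<Sum>n=1..N. \<chi> n * (t ^ n / (1 - t ^ n))) \<le>
           2 * real M + 2 * real M / (1 - t) / real (Suc N)"
proof -
  have "\<bar>\<Sum>n\<in>{1..<Suc N}. \<chi> n * lambert_weight t n\<bar> \<le> 2 * real M * lambert_weight t 1"
    using assms abs_sum_le lambert_weight_nonneg lambert_weight_antimono
    by (intro abs_sum_mult_antimono_le) auto
  then have "- (\<Sum>n=1..N. \<chi> n * lambert_weight t n) \<le> 2 * real M"
    unfolding lambert_weight_1 [OF assms(2,3)] atLeastLessThanSuc_atLeastAtMost by linarith
  moreover have "(\<Sum>n=1..N. \<chi> n * (1 / real n)) / (1 - t) \<le>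
      2 * real M * (1 / real (Suc N)) / (1 - t)"
    using L_one_remainder [of N] assms by (intro divide_right_mono) auto
  moreover have "(\<Sum>n=1..N. \<chi> n * (t ^ n / (1 - t ^ n))) =
      (\<Sum>n=1..N. \<chi> n * (1 / real n)) / (1 - t) - (\<Sum>n=1..N. \<chi> n * lambert_weight t n)"
    by (simp add: lambert_weight_def sum_divide_distrib right_diff_distrib flip: sum_subtractf)
  ultimately show ?thesis by (simp add: mult.commute)
qed

lemma sum_divisor_sum_le_if_L_one_eq_0:
  assumes "L_one = 0"
  shows "(\<Sum>k=1..K. divisor_sum k) \<le> 2 * real M"
proof (rule tendsto_upperbound)
  show "((\<lambda>t. \<Sum>k=1..K. divisor_sum k * t ^ k) \<longlongrightarrow> (\<Sum>k=1..K. divisor_sum k)) (at_left 1)"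
    by (auto intro!: tendsto_eq_intros)
  have "(\<Sum>k=1..K. divisor_sum k * t ^ k) \<le> 2 * real M" if "0 < t" "t < 1" for t
  proof (rule tendsto_lowerbound)
    let ?bound = "\<lambda>N. 2 * real M + 2 * real M / (1 - t) / real (Suc N) + real N * t ^ N / (1 - t)"
    have "(\<lambda>N. real N * t ^ N) \<longlonglongrightarrow> 0"
      using that by (intro powser_times_n_limit_0) auto
    then have "(\<lambda>N. real N * t ^ N / (1 - t)) \<longlonglongrightarrow> 0"
      by (rule tendsto_divide_zero)
    moreover have "(\<lambda>N. 2 * real M / (1 - t) / real (Suc N)) \<longlonglongrightarrow> 0"
      by (rule LIMSEQ_Suc [OF lim_const_over_n])
    ultimately show "?bound \<longlonglongrightarrow> 2 * real M"
      using tendsto_add [OF tendsto_add [OF tendsto_const]] by fastforce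
    show "\<forall>\<^sub>F N in sequentially. (\<Sum>k=1..K. divisor_sum k * t ^ k) \<le> ?bound N"
      using eventually_ge_at_top [of K]
    proof eventually_elim
      case (elim N)
      have "(\<Sum>k=1..K. divisor_sum k * t ^ k) \<le> (\<Sum>k=1..N. divisor_sum k * t ^ k)"
        using elim that by (intro sum_mono2 mult_nonneg_nonneg divisor_sum_nonneg) auto
      then show ?case
        using sum_divisor_sum_power_le [OF that, of N]
            sum_lambert_le_if_L_one_eq_0 [OF assms that, of N]
        by linarith
    qed
  qed auto
  then show "\<forall>\<^sub>F t in at_left 1. (\<Sum>k=1..K. divisor_sum k * t ^ k) \<le> 2 * real M"
    using eventually_at_left_real [of 0 1] by (auto elim: eventually_mono)
qed auto

lemma L_one_nonzero: "L_one \<noteq> 0"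
proof
  assume "L_one = 0"
  then show False
    using sum_divisor_sum_le_if_L_one_eq_0 [of "(2 * M + 1)\<^sup>2"]
      real_le_sum_divisor_sum [of "2 * M + 1"]
    by simp
qed

end

section \<open>Weighted sums of the von Mangoldt function\<close>

definition weighted_mangoldt_sum :: "(nat \<Rightarrow> real) \<Rightarrow> nat \<Rightarrow> real" where
  "weighted_mangoldt_sum f N = (\<Sum>n=1..N. f n * (mangoldt n / real n))"

lemma weighted_mangoldt_sum_nonneg:
  assumes "\<And>n. f n \<ge> 0" shows "weighted_mangoldt_sum f N \<ge> 0"
  unfolding weighted_mangoldt_sum_def using assms mangoldt_nonneg by (intro sum_nonneg) simp

lemma weighted_mangoldt_sum_le_suminf:
  assumes "summable (\<lambda>n. of_bool (n \<in> E) * (mangoldt n / real n))"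
    and "\<And>n. 0 \<le> f n" "\<And>n. f n \<le> B" "\<And>n. n \<notin> E \<Longrightarrow> f n * mangoldt n = 0"
  shows "weighted_mangoldt_sum f N \<le> B * (\<Sum>n. of_bool (n \<in> E) * (mangoldt n / real n))"
proof -
  have "B \<ge> 0" using assms(2,3) order_trans by blast
  have "f n * (mangoldt n / real n) \<le> B * (of_bool (n \<in> E) * (mangoldt n / real n))" for n
    using mult_right_mono [OF assms(3), of "mangoldt n / real n" n] assms(4) [of n]
    by (cases "n \<in> E") (auto simp: mangoldt_nonneg)
  then have "weighted_mangoldt_sum f N \<le> B * (\<Sum>n=1..N. of_bool (n \<in> E) * (mangoldt n / real n))"
    unfolding weighted_mangoldt_sum_def sum_distrib_left by (intro sum_mono)
  also have "\<dots> \<le> B * (\<Sum>n. of_bool (n \<in> E) * (mangoldt n / real n))"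
    using assms(1) \<open>B \<ge> 0\<close> by (intro mult_left_mono sum_le_suminf) (auto simp: mangoldt_nonneg)
  finally show ?thesis .
qed

lemma (in real_character) sum_mult_ln_eq:
  "(\<Sum>n=1..N. \<chi> n * (ln (real n) / real n)) =
     (\<Sum>d=1..N. \<chi> d * (mangoldt d / real d) * (\<Sum>m=1..N div d. \<chi> m * (1 / real m)))"
proof -
  define h where "h d m = \<chi> d * (mangoldt d / real d) * (\<chi> m * (1 / real m))" for d m
  have "\<chi> n * (ln (real n) / real n) = (\<Sum>d | d dvd n. h d (n div d))" if "n \<in> {1..N}" for n
  proof -
    have "\<chi> n / real n * mangoldt d = h d (n div d)" if "d dvd n" for d
      using that \<open>n \<in> {1..N}\<close> by (auto simp: h_def mult elim!: dvdE)
    then have "(\<Sum>d | d dvd n. h d (n div d)) = \<chi> n / real n * (\<Sum>d | d dvd n. mangoldt d)"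
      by (simp add: sum_distrib_left)
    then show ?thesis using that by (simp add: mangoldt_sum)
  qed
  then show ?thesis
    using sum_divisors_swap [of h N] by (simp add: h_def sum_distrib_left)
qed

context nonprincipal_real_character
begin

lemma Bseq_sum_mult_ln: "Bseq (\<lambda>N. \<Sum>n=1..N. \<chi> n * (ln (real n) / real n))"
proof -
  have "ln (real (Suc n)) / real (Suc n) \<le> ln (real n) / real n" if "n \<ge> 3" for n
    using that exp_le by (intro ln_x_over_x_mono) auto
  then have "summable (\<lambda>n. \<chi> n * (ln (real n) / real n))"
    using abs_sum_le filterlim_compose [OF ln_x_over_x_tendsto_0 filterlim_real_sequentially]
    by (intro summable_Dirichlet_test [where a = 3 and B = "2 * real M"]) auto
  then have "Bseq (\<lambda>N. \<Sum>n<N. \<chi> n * (ln (real n) / real n))"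
    by (intro convergent_imp_Bseq) (simp add: summable_iff_convergent)
  then have "Bseq (\<lambda>N. \<Sum>n<Suc N. \<chi> n * (ln (real n) / real n))"
    by (rule Bseq_subseq)
  moreover have "(\<Sum>n<Suc N. \<chi> n * (ln (real n) / real n)) =
      (\<Sum>n=1..N. \<chi> n * (ln (real n) / real n))" for N
    by (intro sum.mono_neutral_right) auto
  ultimately show ?thesis by simp
qed

lemma abs_sum_mangoldt_mult_remainder_le:
  "\<bar>\<Sum>d=1..N. \<chi> d * (mangoldt d / real d) * ((\<Sum>m=1..N div d. \<chi> m * (1 / real m)) - L_one)\<bar>
     \<le> 2 * real M * (2 * ln 4)"
proof (cases "N = 0")
  case False
  let ?R = "\<lambda>d. (\<Sum>m=1..N div d. \<chi> m * (1 / real m)) - L_one"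
  have "\<bar>\<Sum>d=1..N. \<chi> d * (mangoldt d / real d) * ?R d\<bar>
      \<le> (\<Sum>d=1..N. 2 * real M / real N * mangoldt d)"
  proof (intro sum_abs [THEN order_trans] sum_mono)
    fix d assume d_range: "d \<in> {1..N}"
    have "N < d * Suc (N div d)"
      using d_range dividend_less_times_div [of d N] by simp
    then have "real N \<le> real d * real (Suc (N div d))"
      by (metis of_nat_le_iff of_nat_mult less_imp_le)
    then have "1 / real (Suc (N div d)) \<le> real d / real N"
      using False by (simp add: field_simps)
    then have "2 * real M * (1 / real (Suc (N div d))) \<le> 2 * real M * (real d / real N)"
      by (intro mult_left_mono) auto
    with L_one_remainder [of "N div d"] have "\<bar>?R d\<bar> \<le> 2 * real M * (real d / real N)"
      by (rule order_trans)
    then have "\<bar>\<chi> d\<bar> * (mangoldt d / real d) * \<bar>?R d\<bar>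
        \<le> 1 * (mangoldt d / real d) * (2 * real M * (real d / real N))"
      using abs_le_1 [of d] by (intro mult_mono) (auto simp: mangoldt_nonneg)
    then show "\<bar>\<chi> d * (mangoldt d / real d) * ?R d\<bar> \<le> 2 * real M / real N * mangoldt d"
      using d_range by (simp add: abs_mult mult_ac)
  qed
  also have "\<dots> = 2 * real M / real N * chebyshev_psi N"
    by (simp add: chebyshev_psi_def sum_distrib_left)
  also have "\<dots> \<le> 2 * real M / real N * (2 * ln 4 * real N)"
    by (intro mult_left_mono chebyshev_psi_le) auto
  finally show ?thesis using False by simp
qed simp

theorem Bseq_weighted_mangoldt_sum: "Bseq (weighted_mangoldt_sum \<chi>)"
proof -
  obtain C where C_bound: "\<And>N. \<bar>\<Sum>n=1..N. \<chi> n * (ln (real n) / real n)\<bar> \<le> C"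
    using Bseq_sum_mult_ln by (auto simp: Bseq_def)
  have "Bseq (\<lambda>N. L_one * weighted_mangoldt_sum \<chi> N)"
  proof (rule BseqI')
    fix N
    have "(\<Sum>d=1..N. \<chi> d * (mangoldt d / real d) * ((\<Sum>m=1..N div d. \<chi> m * (1 / real m)) - L_one)) =
        (\<Sum>n=1..N. \<chi> n * (ln (real n) / real n)) - L_one * weighted_mangoldt_sum \<chi> N"
      unfolding sum_mult_ln_eq weighted_mangoldt_sum_def
      by (simp add: right_diff_distrib sum_subtractf sum_distrib_right mult.commute [of L_one])
    then show "norm (L_one * weighted_mangoldt_sum \<chi> N) \<le> C + 2 * real M * (2 * ln 4)"
      using C_bound [of N] abs_sum_mangoldt_mult_remainder_le [of N] unfolding real_norm_def
      by linarith
  qed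
  then show ?thesis using L_one_nonzero by (simp add: Bseq_cmult_iff)
qed

end

lemma (in real_character) mult_weighted_mangoldt_sum_bounded_below:
  "\<exists>C. \<forall>N. - C \<le> \<chi> a * weighted_mangoldt_sum \<chi> N"
proof (cases "\<exists>n. \<chi> n = -1")
  case True
  then interpret nonprincipal_real_character \<chi> M by unfold_locales
  obtain C where "\<And>N. \<bar>weighted_mangoldt_sum \<chi> N\<bar> \<le> C"
    using Bseq_weighted_mangoldt_sum by (auto simp: Bseq_def)
  moreover have "\<bar>\<chi> a * x\<bar> \<le> \<bar>x\<bar>" for x
    using mult_right_mono [OF abs_le_1 abs_ge_zero] by (simp add: abs_mult)
  ultimately have "- C \<le> \<chi> a * weighted_mangoldt_sum \<chi> N" for N
    using abs_le_D2 order_trans by (metis neg_le_iff_le minus_minus)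
  then show ?thesis by blast
next
  case False
  then have "\<chi> n \<ge> 0" for n using value_cases [of n] by auto
  then show ?thesis by (intro exI [of _ 0]) (simp add: weighted_mangoldt_sum_nonneg)
qed

section \<open>Primes with prescribed values of real characters\<close>

lemma real_character_mult:
  assumes "real_character \<chi> m" "real_character \<psi> n"
  shows "real_character (\<lambda>k. \<chi> k * \<psi> k) (m * n)"
proof -
  interpret \<chi>: real_character \<chi> m by fact
  interpret \<psi>: real_character \<psi> n by fact
  show ?thesis
  proof
    fix k
    have "\<chi> (k + m * n) = \<chi> k"
      using \<chi>.mod_modulus [of "k + m * n"] \<chi>.mod_modulus [of k] by simp
    moreover have "\<psi> (k + m * n) = \<psi> k"
      using \<psi>.mod_modulus [of "k + m * n"] \<psi>.mod_modulus [of k] by simp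
    ultimately show "\<chi> (k + m * n) * \<psi> (k + m * n) = \<chi> k * \<psi> k" by simp
    show "\<chi> k * \<psi> k \<in> {-1, 1}" if "coprime k (m * n)"
      using that \<chi>.value_if_coprime [of k] \<psi>.value_if_coprime [of k] by auto
    show "\<chi> k * \<psi> k = 0" if "\<not> coprime k (m * n)"
      using that \<chi>.eq_0_if_not_coprime [of k] \<psi>.eq_0_if_not_coprime [of k] by auto
  qed (simp_all add: \<chi>.modulus_pos \<psi>.modulus_pos \<chi>.mult \<psi>.mult)
qed

lemma real_character_prod:
  assumes "finite T" "\<And>\<chi>. \<chi> \<in> T \<Longrightarrow> \<exists>m. real_character \<chi> m"
  shows "\<exists>m. real_character (\<lambda>n. \<Prod>\<chi>\<in>T. \<chi> n) m"
  using assms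
proof (induction T rule: finite_induct)
  case empty
  have "real_character (\<lambda>_. 1) 1" by unfold_locales auto
  then show ?case by auto
next
  case (insert \<chi> T)
  obtain m where "real_character \<chi> m" using insert.prems by blast
  moreover obtain n where "real_character (\<lambda>k. \<Prod>\<psi>\<in>T. \<psi> k) n" using insert by blast
  ultimately have "real_character (\<lambda>k. \<chi> k * (\<Prod>\<psi>\<in>T. \<psi> k)) (m * n)" by (rule real_character_mult)
  then show ?case using insert.hyps by auto
qed

definition agreement_weight :: "(nat \<Rightarrow> real) set \<Rightarrow> nat \<Rightarrow> nat \<Rightarrow> real" where
  "agreement_weight F a n = (\<Prod>\<chi>\<in>F. 1 + \<chi> a * \<chi> n)"

context
  fixes F :: "(nat \<Rightarrow> real) set" and a :: nat
  assumes finite_F: "finite F"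
    and characters: "\<And>\<chi>. \<chi> \<in> F \<Longrightarrow> \<exists>m. real_character \<chi> m"
    and nonzero: "\<And>\<chi>. \<chi> \<in> F \<Longrightarrow> \<chi> a \<noteq> 0"
begin

lemma character_value_cases:
  assumes "\<chi> \<in> F" shows "\<chi> n \<in> {-1, 0, 1}"
  using characters [OF assms] real_character.value_cases by blast

lemma agreement_factor_bounds:
  assumes "\<chi> \<in> F" shows "0 \<le> 1 + \<chi> a * \<chi> n" "1 + \<chi> a * \<chi> n \<le> 2"
  using character_value_cases [OF assms, of a] character_value_cases [OF assms, of n] by auto

lemma agreement_weight_nonneg: "agreement_weight F a n \<ge> 0"
  unfolding agreement_weight_def by (intro prod_nonneg agreement_factor_bounds)

lemma agreement_weight_le: "agreement_weight F a n \<le> 2 ^ card F"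
proof -
  have "agreement_weight F a n \<le> (\<Prod>\<chi>\<in>F. 2)"
    unfolding agreement_weight_def by (intro prod_mono conjI agreement_factor_bounds)
  then show ?thesis by simp
qed

lemma agreement_weight_eq_0:
  assumes "\<chi> \<in> F" "\<chi> n \<notin> {0, \<chi> a}" shows "agreement_weight F a n = 0"
proof -
  have "1 + \<chi> a * \<chi> n = 0"
    using assms nonzero [of \<chi>]
      character_value_cases [of \<chi> a] character_value_cases [of \<chi> n] by auto
  then show ?thesis
    unfolding agreement_weight_def using assms(1) finite_F by (intro prod_zero) auto
qed

lemma agreement_weight_odd_power:
  assumes "odd k" shows "agreement_weight F a (n ^ k) = agreement_weight F a n"
  unfolding agreement_weight_def
proof (intro prod.cong refl)
  fix \<chi> assume "\<chi> \<in> F"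
  then obtain m where "real_character \<chi> m" using characters by blast
  then have "\<chi> (n ^ k) = \<chi> n ^ k" "\<chi> n \<in> {-1, 0, 1}"
    by (simp_all add: real_character.power real_character.value_cases [simplified])
  then show "1 + \<chi> a * \<chi> (n ^ k) = 1 + \<chi> a * \<chi> n"
    using assms odd_pos [OF assms] by auto
qed

lemma weighted_mangoldt_sum_agreement_weight:
  "weighted_mangoldt_sum (agreement_weight F a) N =
     (\<Sum>T\<in>Pow F. (\<Prod>\<chi>\<in>T. \<chi> a) * weighted_mangoldt_sum (\<lambda>n. \<Prod>\<chi>\<in>T. \<chi> n) N)"
proof -
  have "agreement_weight F a n = (\<Sum>T\<in>Pow F. (\<Prod>\<chi>\<in>T. \<chi> a) * (\<Prod>\<chi>\<in>T. \<chi> n))" for n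
    using prod_add [OF finite_F, of "\<lambda>\<chi>. \<chi> a * \<chi> n" "\<lambda>_. 1"]
    by (simp add: agreement_weight_def prod.distrib add.commute)
  then have "weighted_mangoldt_sum (agreement_weight F a) N =
      (\<Sum>n=1..N. \<Sum>T\<in>Pow F. (\<Prod>\<chi>\<in>T. \<chi> a) * ((\<Prod>\<chi>\<in>T. \<chi> n) * (mangoldt n / real n)))"
    by (simp only: weighted_mangoldt_sum_def sum_distrib_right mult.assoc)
  also have "\<dots> = (\<Sum>T\<in>Pow F. \<Sum>n=1..N. (\<Prod>\<chi>\<in>T. \<chi> a) * ((\<Prod>\<chi>\<in>T. \<chi> n) * (mangoldt n / real n)))"
    by (rule sum.swap)
  finally show ?thesis
    by (simp only: weighted_mangoldt_sum_def sum_distrib_left)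
qed

lemma weighted_mangoldt_sum_agreement_weight_ge:
  "\<exists>C. \<forall>N>0. ln (real N) - C \<le> weighted_mangoldt_sum (agreement_weight F a) N"
proof -
  define contribution where
    "contribution T N = (\<Prod>\<chi>\<in>T. \<chi> a) * weighted_mangoldt_sum (\<lambda>n. \<Prod>\<chi>\<in>T. \<chi> n) N" for T N
  have "\<exists>C. \<forall>N. - C \<le> contribution T N" if "T \<subseteq> F" for T
  proof -
    have "\<exists>m. real_character (\<lambda>n. \<Prod>\<chi>\<in>T. \<chi> n) m"
      using that finite_F characters by (intro real_character_prod) (auto intro: finite_subset)
    then show ?thesis
      unfolding contribution_def
      using real_character.mult_weighted_mangoldt_sum_bounded_below by blast
  qed
  then obtain C where C_bound: "\<And>T N. T \<subseteq> F \<Longrightarrow> - C T \<le> contribution T N" by metis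
  have "ln (real N) - (1 + (\<Sum>T\<in>Pow F - {{}}. C T)) \<le> weighted_mangoldt_sum (agreement_weight F a) N"
    if "N > 0" for N
  proof -
    have "(\<Sum>T\<in>Pow F - {{}}. - C T) \<le> (\<Sum>T\<in>Pow F - {{}}. contribution T N)"
      using C_bound by (intro sum_mono) auto
    moreover have "ln (real N) - 1 \<le> contribution {} N"
      using sum_mangoldt_div_ge [OF that]
      by (simp add: contribution_def weighted_mangoldt_sum_def)
    moreover have "weighted_mangoldt_sum (agreement_weight F a) N =
        contribution {} N + (\<Sum>T\<in>Pow F - {{}}. contribution T N)"
      unfolding weighted_mangoldt_sum_agreement_weight contribution_def [symmetric]
      using finite_F by (intro sum.remove) auto
    ultimately show ?thesis by (simp add: sum_negf)
  qed
  then show ?thesis by blast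
qed

lemma weighted_mangoldt_sum_agreement_weight_le:
  assumes no_prime: "\<not> (\<exists>q>K. prime q \<and> (\<forall>\<chi>\<in>F. \<chi> q = \<chi> a))"
  shows "\<exists>C. \<forall>N. weighted_mangoldt_sum (agreement_weight F a) N \<le> C"
proof -
  obtain m where m_modulus: "\<And>\<chi>. \<chi> \<in> F \<Longrightarrow> real_character \<chi> (m \<chi>)" using characters by metis
  define P where "P = {p. prime p \<and> p \<le> K + (\<Sum>\<chi>\<in>F. m \<chi>)}"
  define E where "E = range (\<lambda>k. k\<^sup>2) \<union> (\<Union>p\<in>P. range (\<lambda>k. p ^ k))"
  have weight_outside_P: "agreement_weight F a p = 0" if p_outside: "prime p" "p \<notin> P" for p
  proof -
    obtain \<chi> where disagreement: "\<chi> \<in> F" "\<chi> p \<noteq> \<chi> a"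
      using no_prime p_outside by (auto simp: P_def)
    then have "m \<chi> < p"
      using p_outside member_le_sum [of \<chi> F m] finite_F by (simp add: P_def)
    then have "\<chi> p \<noteq> 0"
      using real_character.nonzero_at_large_prime [OF m_modulus] disagreement(1) p_outside(1)
      by blast
    then show ?thesis using disagreement agreement_weight_eq_0 by simp
  qed
  have weight_outside_E: "agreement_weight F a n * mangoldt n = 0" if "n \<notin> E" for n
  proof (cases "primepow n")
    case True
    then obtain p k where n: "n = p ^ k" "prime p" by (auto simp: primepow_def)
    have "p \<notin> P" using that n by (auto simp: E_def)
    moreover have "odd k"
      using that n by (auto simp: E_def power_mult mult.commute elim!: evenE)
    ultimately show ?thesis
      using n by (simp add: agreement_weight_odd_power weight_outside_P)
  qed (simp add: mangoldt_def)
  have "finite P" by (rule finite_subset [of _ "{..K + (\<Sum>\<chi>\<in>F. m \<chi>)}"]) (auto simp: P_def)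
  then have "summable (\<lambda>n. of_bool (n \<in> E) * (mangoldt n / real n))"
    unfolding E_def
    by (intro summable_of_bool_Un summable_mangoldt_squares summable_mangoldt_prime_powers)
       (auto simp: P_def mangoldt_nonneg)
  then show ?thesis
    using weighted_mangoldt_sum_le_suminf
        [OF _ agreement_weight_nonneg agreement_weight_le weight_outside_E]
    by blast
qed

theorem prime_with_real_character_values: "\<exists>q>K. prime q \<and> (\<forall>\<chi>\<in>F. \<chi> q = \<chi> a)"
proof (rule ccontr)
  assume "\<not> ?thesis"
  then obtain B where upper: "\<And>N. weighted_mangoldt_sum (agreement_weight F a) N \<le> B"
    using weighted_mangoldt_sum_agreement_weight_le by blast
  obtain C where lower:
      "\<And>N. N > 0 \<Longrightarrow> ln (real N) - C \<le> weighted_mangoldt_sum (agreement_weight F a) N"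
    using weighted_mangoldt_sum_agreement_weight_ge by blast
  have "\<forall>\<^sub>F N in sequentially. B + C < ln (real N)"
    using filterlim_compose [OF ln_at_top filterlim_real_sequentially]
    by (simp add: filterlim_at_top_dense)
  then have "\<forall>\<^sub>F N in sequentially. N > 0 \<and> B + C < ln (real N)"
    using eventually_gt_at_top by (rule eventually_conj [rotated])
  then obtain N where N_large: "N > 0" "B + C < ln (real N)"
    by (auto dest: eventually_happens' [OF sequentially_bot])
  then show False using lower [OF N_large(1)] upper [of N] by simp
qed

end

section \<open>Legendre symbols\<close>

lemma Legendre_cases: "Legendre a p \<in> {-1, 0, 1}"
  by (auto simp: Legendre_def)

lemma Legendre_eq_0_iff: "Legendre a p = 0 \<longleftrightarrow> p dvd a"
  by (simp add: Legendre_def cong_0_iff)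

lemma QuadRes_if_Legendre_eq_1: "Legendre a p = 1 \<Longrightarrow> QuadRes p a"
  by (auto simp: Legendre_def split: if_splits)

lemma Legendre_cong:
  assumes "[a = b] (mod p)" shows "Legendre a p = Legendre b p"
proof -
  have "[a = 0] (mod p) \<longleftrightarrow> [b = 0] (mod p)" "QuadRes p a \<longleftrightarrow> QuadRes p b"
    using assms unfolding QuadRes_def by (meson cong_sym cong_trans)+
  then show ?thesis by (simp add: Legendre_def)
qed

lemma Legendre_one: "p > 1 \<Longrightarrow> Legendre 1 p = 1"
  by (auto simp: Legendre_def QuadRes_def cong_def intro!: exI [of _ 1])

lemma eq_if_cong_sign_values:
  fixes x y :: int
  assumes "x \<in> {-1, 0, 1}" "y \<in> {-1, 0, 1}" "[x = y] (mod m)" "m > 2"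
  shows "x = y"
proof -
  have "m dvd x - y" using assms(3) by (simp add: cong_iff_dvd_diff)
  moreover have "\<bar>x - y\<bar> < m" using assms by auto
  ultimately show ?thesis using dvd_imp_le_int [of "x - y" m] by auto
qed

context
  fixes p :: nat
  assumes odd_prime: "prime p" "p > 2"
begin

lemma Legendre_mult: "Legendre (a * b) (int p) = Legendre a (int p) * Legendre b (int p)"
proof (rule eq_if_cong_sign_values)
  show "Legendre a (int p) * Legendre b (int p) \<in> {-1, 0, 1}"
    using Legendre_cases [of a "int p"] Legendre_cases [of b "int p"] by auto
  have "[Legendre (a * b) (int p) = a ^ ((p - 1) div 2) * b ^ ((p - 1) div 2)] (mod int p)"
    using euler_criterion [OF odd_prime, of "a * b"] by (simp add: power_mult_distrib)
  moreover have "[Legendre a (int p) * Legendre b (int p) =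
      a ^ ((p - 1) div 2) * b ^ ((p - 1) div 2)] (mod int p)"
    using odd_prime by (intro cong_mult euler_criterion)
  ultimately show "[Legendre (a * b) (int p) = Legendre a (int p) * Legendre b (int p)] (mod int p)"
    by (metis cong_sym cong_trans)
qed (use odd_prime Legendre_cases in auto)

lemma quadratic_nonresidue_exists: "\<exists>a. Legendre (int a) (int p) = -1"
proof -
  define square_mod where "square_mod y = y\<^sup>2 mod p" for y
  obtain k where "p = 2 + k" using odd_prime(2) le_Suc_ex less_imp_le by blast
  then have "(p - 1)\<^sup>2 = 1 + p * k" by (simp add: power2_eq_square)
  then have "square_mod (p - 1) = square_mod 1"
    unfolding square_mod_def by (simp only: mod_mult_self2) simp
  then have "\<not> inj_on square_mod {..<p}"
    using odd_prime by (auto dest: inj_onD [of square_mod "{..<p}" "p - 1" 1])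
  then obtain a where a_nonsquare: "a < p" "a \<notin> square_mod ` {..<p}"
    using finite_surj_inj [of "{..<p}" square_mod] by blast
  have "\<not> QuadRes (int p) (int a)"
  proof
    assume "QuadRes (int p) (int a)"
    then obtain y where "[y\<^sup>2 = int a] (mod int p)" by (auto simp: QuadRes_def)
    moreover define z where "z = nat (y mod int p)"
    then have z_residue: "int z = y mod int p" "z < p"
      using odd_prime by (simp_all add: nat_less_iff)
    ultimately have "int (z\<^sup>2 mod p) = int a"
      using a_nonsquare(1) by (simp add: cong_def power_mod of_nat_mod)
    then show False using a_nonsquare(2) z_residue(2) by (auto simp: square_mod_def)
  qed
  moreover have "a \<noteq> 0"
    using a_nonsquare(2) odd_prime image_eqI [of 0 square_mod 0 "{..<p}"]
    by (auto simp: square_mod_def)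
  ultimately have "Legendre (int a) (int p) = -1"
    using a_nonsquare(1) by (simp add: Legendre_def cong_def)
  then show ?thesis by blast
qed

end

lemma prime_gt_2_if_cong_1_mod_4:
  fixes q :: nat
  assumes "prime q" "q mod 4 = 1" shows "q > 2"
  using assms prime_ge_2_nat [of q] by (cases "q = 2") auto

lemma Legendre_commute:
  assumes "prime p" "p > 2" "prime q" "q mod 4 = 1" "p \<noteq> q"
  shows "Legendre (int p) (int q) = Legendre (int q) (int p)"
proof -
  have q_gt_2: "q > 2" using assms(3,4) by (rule prime_gt_2_if_cong_1_mod_4)
  have "even ((q - 1) div 2)" using assms(4) by presburger
  then have "Legendre (int p) (int q) * Legendre (int q) (int p) = 1"
    using Quadratic_Reciprocity [OF assms(1,2,3) q_gt_2 assms(5)] by simp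
  then show ?thesis
    using Legendre_cases [of "int p" "int q"] Legendre_cases [of "int q" "int p"] by auto
qed

lemma odd_mod_8_cases: "odd n \<Longrightarrow> n mod 8 \<in> {1, 3, 5, 7}" for n :: nat
  unfolding insert_iff empty_iff by presburger

lemma mod_4_eq_mod_8_mod_4: "n mod 4 = n mod 8 mod 4" for n :: nat
  by (simp add: mod_mod_cancel)

definition chi4 :: "nat \<Rightarrow> int" where
  "chi4 n = (if n mod 4 = 1 then 1 else if n mod 4 = 3 then -1 else 0)"

definition chi8 :: "nat \<Rightarrow> int" where
  "chi8 n = (if n mod 8 \<in> {1, 7} then 1 else if n mod 8 \<in> {3, 5} then -1 else 0)"

lemma chi4_mult: "chi4 (m * n) = chi4 m * chi4 n"
proof -
  have residues: "r mod 4 = 0 \<or> r mod 4 = 1 \<or> r mod 4 = 2 \<or> r mod 4 = 3" for r :: nat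
    by presburger
  show ?thesis
    using residues [of m] residues [of n]
    unfolding chi4_def mod_mult_eq [of m 4 n, symmetric] by (elim disjE) simp_all
qed

lemma chi8_mult: "chi8 (m * n) = chi8 m * chi8 n"
proof -
  have residues: "r mod 8 = 0 \<or> r mod 8 = 1 \<or> r mod 8 = 2 \<or> r mod 8 = 3 \<or>
      r mod 8 = 4 \<or> r mod 8 = 5 \<or> r mod 8 = 6 \<or> r mod 8 = 7" for r :: nat
    by presburger
  show ?thesis
    using residues [of m] residues [of n]
    unfolding chi8_def mod_mult_eq [of m 8 n, symmetric] by (elim disjE) simp_all
qed

lemma Legendre_minus_one:
  assumes "prime p" "p > 2"
  shows "Legendre (-1) (int p) = chi4 p"
proof (rule eq_if_cong_sign_values)
  obtain h where "p = 2 * h + 1" using assms prime_odd_nat by (blast elim: oddE)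
  then have "(-1) ^ ((p - 1) div 2) = chi4 p"
    by (cases "even h") (auto simp: chi4_def elim!: evenE oddE)
  then show "[Legendre (-1) (int p) = chi4 p] (mod int p)"
    using euler_criterion [OF assms, of "-1"] by simp
qed (use assms Legendre_cases in \<open>auto simp: chi4_def\<close>)

lemma Legendre_two:
  assumes "prime p" "p > 2"
  shows "Legendre 2 (int p) = chi8 p"
proof -
  interpret GAUSS p 2
  proof
    show "[2 \<noteq> 0] (mod int p)"
      using assms by (auto simp: cong_0_iff dest: zdvd_imp_le)
  qed (use assms in auto)
  define h where "h = (int p - 1) div 2"
  have p_eq: "int p = 2 * h + 1" "h \<ge> 0" using p_eq2 assms by (simp_all add: h_def)
  have "C = (\<lambda>x. 2 * x) ` {0<..h}"
    unfolding C_def B_def A_def h_def [symmetric] image_image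
    by (intro image_cong refl) (use p_eq in auto)
  then have "E = (\<lambda>x. 2 * x) ` {h div 2<..h}"
    unfolding E_def h_def [symmetric] by auto
  then have "card E = nat (h - h div 2)"
    by (simp add: card_image inj_on_def)
  then have "even (card E) \<longleftrightarrow> even (h - h div 2)"
    using p_eq by (simp add: even_nat_iff)
  also have "\<dots> \<longleftrightarrow> int p mod 8 = 1 \<or> int p mod 8 = 7"
    unfolding p_eq(1) by presburger
  also have "\<dots> \<longleftrightarrow> p mod 8 \<in> {1, 7}" by (simp add: zmod_int [of p 8, simplified, symmetric])
  finally have "even (card E) \<longleftrightarrow> p mod 8 \<in> {1, 7}" .
  moreover have "odd p" using assms by (simp add: prime_odd_nat)
  then have "p mod 8 \<in> {1, 3, 5, 7}" by (rule odd_mod_8_cases)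
  ultimately have "(-1) ^ card E = chi8 p"
    by (auto simp: chi8_def minus_one_power_iff)
  then show ?thesis using gauss_lemma by simp
qed

lemma multiplicative_prod:
  fixes f :: "'a :: comm_monoid_mult \<Rightarrow> 'b :: comm_monoid_mult"
  assumes "\<And>x y. f (x * y) = f x * f y" "f 1 = 1"
  shows "f (\<Prod>i\<in>I. g i) = (\<Prod>i\<in>I. f (g i))"
  by (induction I rule: infinite_finite_induct) (simp_all add: assms)

lemma real_character_chi4: "real_character (\<lambda>n. real_of_int (chi4 n)) 4"
proof
  fix n :: nat
  have coprime_iff: "coprime n 4 \<longleftrightarrow> odd n"
    using coprime_power_right_iff [of n 2 2] by simp
  show "real_of_int (chi4 n) \<in> {-1, 1}" if "coprime n 4"
  proof -
    have "n mod 4 = 1 \<or> n mod 4 = 3" using that unfolding coprime_iff by presburger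
    then show ?thesis by (auto simp: chi4_def)
  qed
  show "real_of_int (chi4 n) = 0" if "\<not> coprime n 4"
  proof -
    have "n mod 4 \<noteq> 1 \<and> n mod 4 \<noteq> 3" using that unfolding coprime_iff by presburger
    then show ?thesis by (simp add: chi4_def)
  qed
qed (simp_all add: chi4_mult, simp add: chi4_def)

lemma real_character_chi8: "real_character (\<lambda>n. real_of_int (chi8 n)) 8"
proof
  fix n :: nat
  have coprime_iff: "coprime n 8 \<longleftrightarrow> odd n"
    using coprime_power_right_iff [of n 2 3] by simp
  show "real_of_int (chi8 n) \<in> {-1, 1}" if "coprime n 8"
  proof -
    have "n mod 8 \<in> {1, 3, 5, 7}" using that unfolding coprime_iff by (rule odd_mod_8_cases)
    then show ?thesis by (auto simp: chi8_def)
  qed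
  show "real_of_int (chi8 n) = 0" if "\<not> coprime n 8"
  proof -
    have "n mod 8 \<noteq> 1 \<and> n mod 8 \<noteq> 3 \<and> n mod 8 \<noteq> 5 \<and> n mod 8 \<noteq> 7"
      using that unfolding coprime_iff by presburger
    then show ?thesis by (simp add: chi8_def)
  qed
qed (simp_all add: chi8_mult, simp add: chi8_def)

lemma real_character_Legendre:
  assumes "prime p" "p > 2"
  shows "real_character (\<lambda>n. real_of_int (Legendre (int n) (int p))) p"
proof
  fix n
  have "coprime p n \<longleftrightarrow> \<not> p dvd n"
    using assms(1) by (metis coprime_absorb_left not_prime_unit prime_imp_coprime)
  then have coprime_iff: "coprime n p \<longleftrightarrow> Legendre (int n) (int p) \<noteq> 0"
    by (simp add: Legendre_eq_0_iff coprime_commute)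
  show "real_of_int (Legendre (int (n + p)) (int p)) = real_of_int (Legendre (int n) (int p))"
    by (simp add: Legendre_cong [of "int n + int p" "int n"] cong_def)
  show "real_of_int (Legendre (int n) (int p)) \<in> {-1, 1}" if "coprime n p"
    using that Legendre_cases [of "int n" "int p"] by (auto simp: coprime_iff)
  show "real_of_int (Legendre (int n) (int p)) = 0" if "\<not> coprime n p"
    using that by (simp add: coprime_iff)
qed (use assms in \<open>simp_all add: Legendre_mult\<close>)

lemma cong_8_if_chi_eq:
  assumes "odd m" "odd n" "chi4 m = chi4 n" "chi8 m = chi8 n"
  shows "[m = n] (mod 8)"
  using odd_mod_8_cases [OF assms(1)] odd_mod_8_cases [OF assms(2)] assms(3,4)
    mod_4_eq_mod_8_mod_4 [of m] mod_4_eq_mod_8_mod_4 [of n]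
  by (auto simp: chi4_def chi8_def cong_def)

lemma cong_8_Legendre_values_solvable:
  assumes odd_primes: "finite P" "\<And>p. p \<in> P \<Longrightarrow> prime p \<and> p > 2"
    and signs: "\<And>p. p \<in> P \<Longrightarrow> \<delta> p \<in> {-1, 1 :: int}"
  shows "\<exists>a. [a = s] (mod 8) \<and> (\<forall>p\<in>P. Legendre (int a) (int p) = \<delta> p)"
proof -
  have "\<exists>r. Legendre (int r) (int p) = \<delta> p" if "p \<in> P" for p
  proof (cases "\<delta> p = 1")
    case True
    then show ?thesis
      using odd_primes(2) [OF that] by (intro exI [of _ 1]) (simp add: Legendre_one)
  next
    case False
    then show ?thesis
      using odd_primes(2) [OF that] signs [OF that] quadratic_nonresidue_exists by auto
  qed
  then obtain r where r_values: "\<And>p. p \<in> P \<Longrightarrow> Legendre (int (r p)) (int p) = \<delta> p" by metis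
  have coprime_8: "coprime 8 p" if "p \<in> P" for p :: nat
    using odd_primes(2) [OF that] coprime_power_left_iff [of 2 3 p] by (simp add: prime_odd_nat)
  then have "8 \<notin> P" by force
  have "\<exists>a. \<forall>i\<in>insert 8 P. [a = (if i = 8 then s else r i)] (mod i)"
    using odd_primes coprime_8
    by (intro chinese_remainder_nat) (auto simp: coprime_commute intro: primes_coprime)
  then obtain a where a_cong: "[a = s] (mod 8)" "\<And>p. p \<in> P \<Longrightarrow> [a = r p] (mod p)"
    using \<open>8 \<notin> P\<close> by (metis insertI1 insertI2)
  then have "Legendre (int a) (int p) = \<delta> p" if "p \<in> P" for p
    using that r_values Legendre_cong [of "int a" "int (r p)" "int p"] by (simp add: cong_int_iff)
  then show ?thesis using a_cong(1) by blast
qed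

theorem prime_cong_8_with_Legendre_values:
  assumes odd_primes: "finite P" "\<And>p. p \<in> P \<Longrightarrow> prime p \<and> p > 2"
    and signs: "\<And>p. p \<in> P \<Longrightarrow> \<delta> p \<in> {-1, 1 :: int}" and "odd s"
  shows "\<exists>q>K. prime q \<and> [q = s] (mod 8) \<and> (\<forall>p\<in>P. Legendre (int q) (int p) = \<delta> p)"
proof -
  obtain a where a_values: "[a = s] (mod 8)" "\<And>p. p \<in> P \<Longrightarrow> Legendre (int a) (int p) = \<delta> p"
    using cong_8_Legendre_values_solvable [of P \<delta> s] odd_primes signs by blast
  have "odd a"
    using a_values(1) \<open>odd s\<close> cong_dvd_modulus_nat [of a s 8 2]
    by (auto simp: cong_def odd_iff_mod_2_eq_one)
  let ?\<chi>4 = "\<lambda>n. real_of_int (chi4 n)" and ?\<chi>8 = "\<lambda>n. real_of_int (chi8 n)"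
  let ?\<chi> = "\<lambda>p n. real_of_int (Legendre (int n) (int p))"
  have "\<exists>q>K + 2. prime q \<and> (\<forall>\<chi>\<in>{?\<chi>4, ?\<chi>8} \<union> ?\<chi> ` P. \<chi> q = \<chi> a)"
  proof (rule prime_with_real_character_values)
    show "finite ({?\<chi>4, ?\<chi>8} \<union> ?\<chi> ` P)" using odd_primes(1) by simp
    show "\<exists>m. real_character \<chi> m" if "\<chi> \<in> {?\<chi>4, ?\<chi>8} \<union> ?\<chi> ` P" for \<chi>
      using that odd_primes(2) real_character_chi4 real_character_chi8 real_character_Legendre
      by auto
    have "coprime a 4" "coprime a 8"
      using \<open>odd a\<close> coprime_power_right_iff [of a 2 2] coprime_power_right_iff [of a 2 3]
      by simp_all
    then have "?\<chi>4 a \<noteq> 0" "?\<chi>8 a \<noteq> 0"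
      using real_character.value_if_coprime real_character_chi4 real_character_chi8 by fastforce+
    then show "\<chi> a \<noteq> 0" if "\<chi> \<in> {?\<chi>4, ?\<chi>8} \<union> ?\<chi> ` P" for \<chi>
      using that a_values(2) signs by fastforce
  qed
  then obtain q where q_values: "q > K + 2" "prime q" "chi4 q = chi4 a" "chi8 q = chi8 a"
      "\<And>p. p \<in> P \<Longrightarrow> Legendre (int q) (int p) = Legendre (int a) (int p)"
    by auto
  then have "[q = a] (mod 8)"
    using \<open>odd a\<close> by (intro cong_8_if_chi_eq) (auto simp: prime_odd_nat)
  then show ?thesis using q_values a_values by (intro exI [of _ q]) (auto intro: cong_trans)
qed

section \<open>The equation x^2 + D y^2 = N w^2\<close>

lemma QuadRes_mult_coprime:
  assumes "QuadRes m a" "QuadRes n a" "coprime m n"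
  shows "QuadRes (m * n) a"
proof -
  obtain y z where y_root: "[y\<^sup>2 = a] (mod m)" and z_root: "[z\<^sup>2 = a] (mod n)"
    using assms by (auto simp: QuadRes_def)
  obtain x where x_cong: "[x = y] (mod m)" "[x = z] (mod n)"
    using binary_chinese_remainder_int [OF assms(3)] by blast
  have "[x\<^sup>2 = a] (mod m)" using cong_trans [OF cong_pow [OF x_cong(1)] y_root] .
  moreover have "[x\<^sup>2 = a] (mod n)" using cong_trans [OF cong_pow [OF x_cong(2)] z_root] .
  ultimately have "[x\<^sup>2 = a] (mod m * n)" using assms(3) by (rule coprime_cong_mult)
  then show ?thesis by (auto simp: QuadRes_def)
qed

lemma QuadRes_prod_coprime:
  assumes "finite I" "\<And>i. i \<in> I \<Longrightarrow> QuadRes (m i) a"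
    and "\<And>i j. i \<in> I \<Longrightarrow> j \<in> I \<Longrightarrow> i \<noteq> j \<Longrightarrow> coprime (m i) (m j)"
  shows "QuadRes (\<Prod>i\<in>I. m i) a"
  using assms
proof (induction I rule: finite_induct)
  case (insert i I)
  have "coprime (m i) (\<Prod>i\<in>I. m i)"
    using insert.hyps insert.prems(2) by (intro prod_coprime_right) auto
  then show ?case using insert by (simp add: QuadRes_mult_coprime)
qed (simp add: QuadRes_def)

lemma QuadRes_two: "QuadRes 2 a"
  by (cases "even a") (auto simp: QuadRes_def cong_def odd_iff_mod_2_eq_one
      intro: exI [of _ 0] exI [of _ 1])

lemma simultaneous_congruences_pigeonhole:
  fixes N D A B C :: nat and t s :: int
  assumes "N > 0" "D > 0" "N * D < (A + 1) * (B + 1) * (C + 1)"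
  obtains x y w :: int where "x \<noteq> 0 \<or> y \<noteq> 0 \<or> w \<noteq> 0"
    "\<bar>x\<bar> \<le> int A" "\<bar>y\<bar> \<le> int B" "\<bar>w\<bar> \<le> int C"
    "[x = t * y] (mod int N)" "[x = s * w] (mod int D)"
proof -
  define box where "box = {0..int A} \<times> {0..int B} \<times> {0..int C}"
  define residues where "residues = {0..<int N} \<times> {0..<int D}"
  define \<phi> where "\<phi> = (\<lambda>(x, y, w). ((x - t * y) mod int N, (x - s * w) mod int D))"
  have "\<phi> ` box \<subseteq> residues" using assms by (auto simp: box_def residues_def \<phi>_def)
  moreover have "card residues < card box"
    using assms(3)
    by (simp add: box_def residues_def card_cartesian_product nat_add_distrib algebra_simps)
  moreover have "finite residues" by (simp add: residues_def)
  ultimately have "\<not> inj_on \<phi> box"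
    using card_inj_on_le linorder_not_less by blast
  then obtain u v where "u \<in> box" "v \<in> box" "\<phi> u = \<phi> v" "u \<noteq> v" unfolding inj_on_def by blast
  moreover obtain x1 y1 w1 x2 y2 w2 where coordinates: "u = (x1, y1, w1)" "v = (x2, y2, w2)"
    by (cases u, cases v) auto
  ultimately have "[x1 - t * y1 = x2 - t * y2] (mod int N)"
      "[x1 - s * w1 = x2 - s * w2] (mod int D)"
    by (auto simp: \<phi>_def cong_def)
  then have "[x1 - x2 = t * (y1 - y2)] (mod int N)" "[x1 - x2 = s * (w1 - w2)] (mod int D)"
    by (auto simp: cong_iff_dvd_diff algebra_simps)
  moreover have "\<bar>x1 - x2\<bar> \<le> int A" "\<bar>y1 - y2\<bar> \<le> int B" "\<bar>w1 - w2\<bar> \<le> int C"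
    using \<open>u \<in> box\<close> \<open>v \<in> box\<close> by (auto simp: coordinates box_def)
  moreover have "x1 - x2 \<noteq> 0 \<or> y1 - y2 \<noteq> 0 \<or> w1 - w2 \<noteq> 0"
    using \<open>u \<noteq> v\<close> by (auto simp: coordinates)
  ultimately show ?thesis using that by blast
qed

lemma power2_le_if_abs_le_floor_sqrt:
  fixes x :: int
  assumes "\<bar>x\<bar> \<le> int (floor_sqrt n)" shows "x\<^sup>2 \<le> int n"
proof -
  have "(nat \<bar>x\<bar>)\<^sup>2 \<le> n" using assms by (simp add: nat_le_iff flip: le_floor_sqrt_iff)
  then have "int ((nat \<bar>x\<bar>)\<^sup>2) \<le> int n" by (simp only: of_nat_le_iff)
  then show ?thesis by simp
qed

lemma small_solution_of_simultaneous_congruences: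
  fixes N D :: nat and t s :: int
  assumes "N > 0" "D > 0"
  obtains x y w :: int where "x \<noteq> 0 \<or> y \<noteq> 0 \<or> w \<noteq> 0"
    "x\<^sup>2 \<le> int (N * D)" "y\<^sup>2 < int N" "w\<^sup>2 < int D"
    "[x = t * y] (mod int N)" "[x = s * w] (mod int D)"
proof -
  define A B C where "A = floor_sqrt (N * D)"
    and "B = floor_sqrt (N - 1)" and "C = floor_sqrt (D - 1)"
  have "N * D < (A + 1)\<^sup>2" "N \<le> (B + 1)\<^sup>2" "D \<le> (C + 1)\<^sup>2"
    using Suc_floor_sqrt_power2_gt [of "N * D"] Suc_floor_sqrt_power2_gt [of "N - 1"]
      Suc_floor_sqrt_power2_gt [of "D - 1"] assms
    by (simp_all add: A_def B_def C_def)
  then have "(N * D) * (N * D) < (A + 1)\<^sup>2 * ((B + 1)\<^sup>2 * (C + 1)\<^sup>2)"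
    using assms by (intro mult_less_le_imp_less mult_le_mono) auto
  then have "(N * D)\<^sup>2 < ((A + 1) * (B + 1) * (C + 1))\<^sup>2"
    by (simp only: power2_eq_square mult_ac)
  then have "N * D < (A + 1) * (B + 1) * (C + 1)" by (rule power2_less_imp_less) simp
  then obtain x y w where solution: "x \<noteq> 0 \<or> y \<noteq> 0 \<or> w \<noteq> 0"
      "[x = t * y] (mod int N)" "[x = s * w] (mod int D)"
    and bounds: "\<bar>x\<bar> \<le> int A" "\<bar>y\<bar> \<le> int B" "\<bar>w\<bar> \<le> int C"
    by (rule simultaneous_congruences_pigeonhole [OF assms])
  have "x\<^sup>2 \<le> int (N * D)" "y\<^sup>2 \<le> int (N - 1)" "w\<^sup>2 \<le> int (D - 1)"
    using bounds [unfolded A_def B_def C_def] by (blast intro: power2_le_if_abs_le_floor_sqrt)+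
  then show ?thesis using solution assms by (intro that [of x y w]) auto
qed

lemma dvd_diff_squares_if_cong:
  fixes x y m a t :: int
  assumes "[t\<^sup>2 = a] (mod m)" "[x = t * y] (mod m)" shows "m dvd x\<^sup>2 - a * y\<^sup>2"
proof -
  have "[x\<^sup>2 = (t * y)\<^sup>2] (mod m)" using assms(2) by (rule cong_pow)
  also have "(t * y)\<^sup>2 = t\<^sup>2 * y\<^sup>2" by (rule power_mult_distrib)
  also have "[t\<^sup>2 * y\<^sup>2 = a * y\<^sup>2] (mod m)" using assms(1) by (rule cong_mult) simp
  finally show ?thesis by (simp add: cong_iff_dvd_diff)
qed

lemma small_multiple_represented:
  fixes N D :: nat
  assumes "N > 0" "D > 0" "coprime N D" "QuadRes (int N) (- int D)" "QuadRes (int D) (int N)"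
  obtains x y w :: int where "x \<noteq> 0 \<or> y \<noteq> 0 \<or> w \<noteq> 0"
    "x\<^sup>2 + int D * y\<^sup>2 - int N * w\<^sup>2 \<in> {0, int N * int D}"
proof -
  obtain t s where roots: "[t\<^sup>2 = - int D] (mod int N)" "[s\<^sup>2 = int N] (mod int D)"
    using assms by (auto simp: QuadRes_def)
  obtain x y w :: int where nonzero: "x \<noteq> 0 \<or> y \<noteq> 0 \<or> w \<noteq> 0"
    and small: "x\<^sup>2 \<le> int (N * D)" "y\<^sup>2 < int N" "w\<^sup>2 < int D"
    and x_cong: "[x = t * y] (mod int N)" "[x = s * w] (mod int D)"
    using small_solution_of_simultaneous_congruences [OF assms(1,2)] by blast
  define v where "v = x\<^sup>2 + int D * y\<^sup>2 - int N * w\<^sup>2"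
  have "int N dvd v"
    using dvd_diff [OF dvd_diff_squares_if_cong [OF roots(1) x_cong(1)], of "int N * w\<^sup>2"]
    by (simp add: v_def)
  moreover have "int D dvd v"
    using dvd_add [OF dvd_diff_squares_if_cong [OF roots(2) x_cong(2)], of "int D * y\<^sup>2"]
    by (simp add: v_def algebra_simps)
  ultimately have "int (N * D) dvd v" using assms(3) by (simp add: divides_mult)
  then obtain k where v_eq: "v = int (N * D) * k" by auto
  have "int D * y\<^sup>2 < int (N * D)" "int N * w\<^sup>2 < int (N * D)"
    using small assms(1,2) by simp_all
  moreover have "0 \<le> x\<^sup>2" "0 \<le> int D * y\<^sup>2" "0 \<le> int N * w\<^sup>2" by auto
  ultimately have "int (N * D) * k < int (N * D) * 2" "int (N * D) * (-1) < int (N * D) * k"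
    using small(1) unfolding v_eq [symmetric] v_def by linarith+
  moreover have "int (N * D) > 0" using assms(1,2) by simp
  ultimately have "k < 2" "-1 < k" by (simp_all only: mult_less_cancel_left_pos)
  then have "k = 0 \<or> k = 1" by linarith
  then have "v \<in> {0, int N * int D}" using v_eq by auto
  then show ?thesis using that nonzero unfolding v_def by blast
qed

lemma Legendre_equation_solvable:
  fixes N D :: nat
  assumes "N > 0" "D > 0" "coprime N D" "QuadRes (int N) (- int D)" "QuadRes (int D) (int N)"
  shows "\<exists>x y w :: int. w \<noteq> 0 \<and> x\<^sup>2 + int D * y\<^sup>2 = int N * w\<^sup>2"
proof -
  obtain x y w :: int where nonzero: "x \<noteq> 0 \<or> y \<noteq> 0 \<or> w \<noteq> 0"
    and "x\<^sup>2 + int D * y\<^sup>2 - int N * w\<^sup>2 \<in> {0, int N * int D}"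
    using assms by (rule small_multiple_represented)
  then consider "x\<^sup>2 + int D * y\<^sup>2 = int N * w\<^sup>2" | "x\<^sup>2 + int D * y\<^sup>2 = int N * (w\<^sup>2 + int D)"
    by (auto simp: algebra_simps)
  then show ?thesis
  proof cases
    case 1
    have "w \<noteq> 0"
    proof
      assume "w = 0"
      then have "x\<^sup>2 = 0 \<and> int D * y\<^sup>2 = 0"
        using 1 by (simp add: add_nonneg_eq_0_iff)
      then show False using nonzero assms(2) \<open>w = 0\<close> by auto
    qed
    then show ?thesis using 1 by blast
  next
    case 2
    then have "(x\<^sup>2 + int D * y\<^sup>2) * (w\<^sup>2 + int D) = int N * (w\<^sup>2 + int D)\<^sup>2"
      by (simp add: power2_eq_square)
    then have "(x * w - int D * y)\<^sup>2 + int D * (x + y * w)\<^sup>2 = int N * (w\<^sup>2 + int D)\<^sup>2"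
      by (simp add: power2_eq_square algebra_simps)
    moreover have "w\<^sup>2 + int D \<noteq> 0" using add_nonneg_pos [of "w\<^sup>2" "int D"] assms(2) by simp
    ultimately show ?thesis by blast
  qed
qed

section \<open>Sums of three squares\<close>

lemma nearest_multiple:
  fixes x t :: int
  assumes "t > 0" shows "\<exists>y. 2 * \<bar>t * y - x\<bar> \<le> t"
proof -
  define r where "r = (2 * x + t) mod (2 * t)"
  have "2 * x + t = 2 * (t * ((2 * x + t) div (2 * t))) + r"
    unfolding r_def using mult_div_mod_eq [of "2 * t" "2 * x + t"] by (simp only: mult.assoc)
  moreover have "0 \<le> r" "r < 2 * t" using assms by (simp_all add: r_def)
  ultimately have "2 * \<bar>t * ((2 * x + t) div (2 * t)) - x\<bar> \<le> t"
    by (simp add: abs_if)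
  then show ?thesis by blast
qed

text \<open>The line through the rational point x / t of the sphere and the lattice point y meets
  the sphere in a second rational point, which has the denominator t'.\<close>
lemma second_rational_point:
  fixes x y :: "'i \<Rightarrow> int" and N t :: int
  assumes on_sphere: "N * t\<^sup>2 = (\<Sum>i\<in>I. (x i)\<^sup>2)"
  defines "a \<equiv> (\<Sum>i\<in>I. (y i)\<^sup>2) - N" and "b \<equiv> 2 * (N * t - (\<Sum>i\<in>I. x i * y i))"
  defines "t' \<equiv> a * t + b"
  shows "t * t' = (\<Sum>i\<in>I. (t * y i - x i)\<^sup>2)" and "N * t'\<^sup>2 = (\<Sum>i\<in>I. (a * x i + b * y i)\<^sup>2)"
proof -
  define X Y where "X = (\<Sum>i\<in>I. x i * y i)" and "Y = (\<Sum>i\<in>I. (y i)\<^sup>2)"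
  note ab = a_def [folded Y_def] b_def [folded X_def]
  have "(\<Sum>i\<in>I. (t * y i - x i)\<^sup>2) = t\<^sup>2 * Y - 2 * t * X + N * t\<^sup>2"
    unfolding X_def Y_def on_sphere
    by (simp add: power2_diff power_mult_distrib sum.distrib sum_subtractf sum_distrib_left mult_ac)
  then show "t * t' = (\<Sum>i\<in>I. (t * y i - x i)\<^sup>2)"
    by (simp add: t'_def ab power2_eq_square algebra_simps)
  have "(\<Sum>i\<in>I. (a * x i + b * y i)\<^sup>2) = a\<^sup>2 * (N * t\<^sup>2) + 2 * a * b * X + b\<^sup>2 * Y"
    unfolding X_def Y_def on_sphere
    by (simp add: power2_sum power_mult_distrib sum.distrib sum_distrib_left mult_ac)
  also have "\<dots> = a\<^sup>2 * (N * t\<^sup>2) + a * b * (2 * N * t - b) + b\<^sup>2 * (a + N)"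
    by (simp add: ab algebra_simps)
  also have "\<dots> = N * t'\<^sup>2"
    by (simp add: t'_def power2_eq_square algebra_simps)
  finally show "N * t'\<^sup>2 = (\<Sum>i\<in>I. (a * x i + b * y i)\<^sup>2)" ..
qed

lemma Davenport_Cassels_descent:
  fixes x :: "'i \<Rightarrow> int" and N t :: int
  assumes "finite I" "card I \<le> 3" "t > 0" and on_sphere: "N * t\<^sup>2 = (\<Sum>i\<in>I. (x i)\<^sup>2)"
  shows "(\<exists>y. N = (\<Sum>i\<in>I. (y i)\<^sup>2)) \<or> (\<exists>t'>0. t' < t \<and> (\<exists>y. N * t'\<^sup>2 = (\<Sum>i\<in>I. (y i)\<^sup>2)))"
proof -
  have "\<exists>y. \<forall>i. 2 * \<bar>t * y i - x i\<bar> \<le> t"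
    by (intro choice allI nearest_multiple \<open>t > 0\<close>)
  then obtain y where y_nearest: "\<And>i. 2 * \<bar>t * y i - x i\<bar> \<le> t" by blast
  define r where "r = (\<Sum>i\<in>I. (t * y i - x i)\<^sup>2)"
  obtain t' z where t': "t * t' = r" "N * t'\<^sup>2 = (\<Sum>i\<in>I. (z i)\<^sup>2)"
    by (rule that [OF second_rational_point [OF on_sphere, of y, folded r_def]])
  show ?thesis
  proof (cases "r = 0")
    case True
    then have "t * y i = x i" if "i \<in> I" for i
      using that \<open>finite I\<close> by (simp add: r_def sum_nonneg_eq_0_iff)
    then have "N * t\<^sup>2 = (\<Sum>i\<in>I. (y i)\<^sup>2) * t\<^sup>2"
      unfolding on_sphere sum_distrib_right
      by (intro sum.cong) (auto simp flip: power_mult_distrib simp: mult.commute)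
    then show ?thesis using \<open>t > 0\<close> by auto
  next
    case False
    then have "r > 0" using sum_nonneg [of I "\<lambda>i. (t * y i - x i)\<^sup>2"] by (simp add: r_def)
    have "4 * (t * y i - x i)\<^sup>2 \<le> t\<^sup>2" for i
      using power_mono [OF y_nearest [of i], of 2] by (simp add: power_mult_distrib)
    then have "4 * r \<le> (\<Sum>i\<in>I. t\<^sup>2)"
      unfolding r_def sum_distrib_left by (intro sum_mono)
    also have "\<dots> \<le> 3 * t\<^sup>2" using \<open>card I \<le> 3\<close> by (simp add: mult_right_mono)
    also have "\<dots> < 4 * t\<^sup>2" using \<open>t > 0\<close> by simp
    finally have "t * t' < t * t" by (simp add: t'(1) power2_eq_square)
    then have "t' < t" using \<open>t > 0\<close> by simp
    moreover have "t' > 0"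
      using \<open>r > 0\<close> \<open>t > 0\<close> unfolding t'(1) [symmetric] by (simp add: zero_less_mult_iff)
    ultimately show ?thesis using t'(2) by blast
  qed
qed

theorem Davenport_Cassels:
  fixes x :: "'i \<Rightarrow> int" and N t :: int
  assumes "finite I" "card I \<le> 3" "t > 0" "N * t\<^sup>2 = (\<Sum>i\<in>I. (x i)\<^sup>2)"
  shows "\<exists>y. N = (\<Sum>i\<in>I. (y i)\<^sup>2)"
  using assms(3,4)
proof (induction "nat t" arbitrary: t x rule: less_induct)
  case less
  consider "\<exists>y. N = (\<Sum>i\<in>I. (y i)\<^sup>2)"
    | t' y where "0 < t'" "t' < t" "N * t'\<^sup>2 = (\<Sum>i\<in>I. (y i)\<^sup>2)"
    using Davenport_Cassels_descent [OF assms(1,2) less.prems] by blast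
  then show ?case
    by cases (use less.hyps less.prems in auto)
qed

definition sum_of_three_squares :: "int \<Rightarrow> bool" where
  "sum_of_three_squares n \<longleftrightarrow> (\<exists>a b c. n = a\<^sup>2 + b\<^sup>2 + c\<^sup>2)"

lemma sum_of_three_squares_if_rational:
  assumes "t \<noteq> 0" "N * t\<^sup>2 = x\<^sup>2 + y\<^sup>2 + z\<^sup>2"
  shows "sum_of_three_squares N"
proof -
  have sum_3: "(\<Sum>i<3. f i) = f 0 + f 1 + f 2" for f :: "nat \<Rightarrow> int"
    by (simp add: eval_nat_numeral)
  have "\<exists>u. N = (\<Sum>i<3::nat. (u i)\<^sup>2)"
    using assms
    by (intro Davenport_Cassels [of _ "\<bar>t\<bar>" _ "(!) [x, y, z]"]) (auto simp: sum_3)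
  then show ?thesis by (auto simp: sum_of_three_squares_def sum_3)
qed

lemma sum_of_three_squares_if_QuadRes:
  fixes N D :: nat
  assumes "N > 0" "D > 0" "coprime N D"
    and "QuadRes (int N) (- int D)" "QuadRes (int D) (int N)" "QuadRes (int D) (-1)"
  shows "sum_of_three_squares (int N)"
proof -
  obtain x y w :: int where N_eq: "w \<noteq> 0" "x\<^sup>2 + int D * y\<^sup>2 = int N * w\<^sup>2"
    using Legendre_equation_solvable [OF assms(1-5)] by blast
  obtain a b c :: int where D_eq: "c \<noteq> 0" "a\<^sup>2 + b\<^sup>2 = int D * c\<^sup>2"
    using Legendre_equation_solvable [of D 1] assms by (auto simp: QuadRes_def)
  have "int N * (w * c)\<^sup>2 = (x\<^sup>2 + int D * y\<^sup>2) * c\<^sup>2" by (simp add: N_eq(2) power_mult_distrib)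
  also have "\<dots> = (x * c)\<^sup>2 + (a\<^sup>2 + b\<^sup>2) * y\<^sup>2"
    by (simp add: D_eq(2) power_mult_distrib algebra_simps)
  also have "\<dots> = (x * c)\<^sup>2 + (a * y)\<^sup>2 + (b * y)\<^sup>2"
    by (simp add: power_mult_distrib algebra_simps)
  finally show ?thesis
    using N_eq(1) D_eq(1) by (intro sum_of_three_squares_if_rational [of "w * c"]) auto
qed

lemma squarefree_eq_prod_prime_factors:
  assumes "squarefree (N :: nat)" shows "(\<Prod>p\<in>prime_factors N. p) = N"
proof -
  have nonzero: "N \<noteq> 0" using assms by (metis not_squarefree_0)
  have "N = (\<Prod>p\<in>prime_factors N. p ^ multiplicity p N)"
    using nonzero by (intro prime_factorization_nat) auto
  also have "\<dots> = (\<Prod>p\<in>prime_factors N. p)"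
    using assms squarefree_factorial_semiring' [OF nonzero] by (intro prod.cong) auto
  finally show ?thesis ..
qed

lemma sum_of_three_squares_if_Legendre:
  fixes N q e :: nat
  assumes squarefree_N: "squarefree N" and e_cases: "e = 1 \<or> e = 2 \<and> odd N"
    and q_prime: "prime q" "q mod 4 = 1" "q > N"
    and Legendre_q: "\<And>p. p \<in> prime_factors N - {2} \<Longrightarrow>
      Legendre (int q) (int p) = Legendre (- int e) (int p)"
    and Legendre_N: "Legendre (int N) (int q) = 1"
  shows "sum_of_three_squares (int N)"
proof (rule sum_of_three_squares_if_QuadRes)
  have "N > 0" using squarefree_N by (cases "N = 0") auto
  have q_gt_2: "q > 2" using q_prime(1,2) by (rule prime_gt_2_if_cong_1_mod_4)
  show "N > 0" by fact
  show "e * q > 0" using e_cases q_gt_2 by auto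
  have "coprime q N"
    using q_prime \<open>N > 0\<close> by (intro prime_imp_coprime) (auto dest: dvd_imp_le)
  then show "coprime N (e * q)" using e_cases by (auto simp: coprime_commute)
  have QuadRes_eq: "QuadRes (int (e * q)) a" if "QuadRes (int q) a" for a
    using e_cases
  proof
    assume "e = 2 \<and> odd N"
    moreover have "coprime 2 (int q)" using q_prime(1) q_gt_2 by (simp add: prime_odd_nat)
    ultimately show ?thesis using QuadRes_mult_coprime [OF QuadRes_two that] by simp
  qed (use that in simp)
  show "QuadRes (int (e * q)) (int N)"
    using Legendre_N by (intro QuadRes_eq QuadRes_if_Legendre_eq_1)
  show "QuadRes (int (e * q)) (-1)"
    using Legendre_minus_one [OF q_prime(1) q_gt_2] q_prime(2)
    by (intro QuadRes_eq QuadRes_if_Legendre_eq_1) (simp add: chi4_def)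
  have "QuadRes (int p) (- int (e * q))" if p_factor: "p \<in> prime_factors N" for p
  proof (cases "p = 2")
    case False
    then have odd_p: "prime p" "p > 2"
      using p_factor prime_ge_2_nat [of p] by (auto simp: le_less)
    then have "\<not> int p dvd - int e" using e_cases by (auto dest: dvd_imp_le)
    then have "Legendre (- int e) (int p) * Legendre (- int e) (int p) = 1"
      using Legendre_cases [of "- int e" "int p"] by (auto simp: Legendre_eq_0_iff)
    then show ?thesis
      using Legendre_mult [OF odd_p, of "- int e" "int q"] Legendre_q [of p] p_factor False
      by (intro QuadRes_if_Legendre_eq_1) simp
  qed (simp add: QuadRes_two)
  then have "QuadRes (\<Prod>p\<in>prime_factors N. int p) (- int (e * q))"
    by (intro QuadRes_prod_coprime) (auto intro: primes_coprime)
  then show "QuadRes (int N) (- int (e * q))"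
    using squarefree_eq_prod_prime_factors [OF squarefree_N] by (simp flip: of_nat_prod)
qed

lemma Legendre_prod_commute:
  assumes odd_primes: "finite P" "\<And>p. p \<in> P \<Longrightarrow> prime p \<and> p > 2"
    and q_prime: "prime q" "q mod 4 = 1" "q \<notin> P"
  shows "Legendre (int (\<Prod>p\<in>P. p)) (int q) = (\<Prod>p\<in>P. Legendre (int q) (int p))"
proof -
  have q_gt_2: "q > 2" using q_prime(1,2) by (rule prime_gt_2_if_cong_1_mod_4)
  have "Legendre (int (\<Prod>p\<in>P. p)) (int q) = (\<Prod>p\<in>P. Legendre (int p) (int q))"
    using q_gt_2 q_prime(1)
    by (intro multiplicative_prod [where f = "\<lambda>n. Legendre (int n) (int q)"])
      (simp_all add: Legendre_mult Legendre_one)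
  also have "\<dots> = (\<Prod>p\<in>P. Legendre (int q) (int p))"
    using odd_primes q_prime by (intro prod.cong refl Legendre_commute) auto
  finally show ?thesis .
qed

lemma Legendre_minus_two:
  assumes "prime p" "p > 2"
  shows "Legendre (-2) (int p) = chi4 p * chi8 p"
  using Legendre_mult [OF assms, of "-1" 2] by (simp add: Legendre_minus_one Legendre_two assms)

lemma prod_Legendre_minus:
  assumes "\<And>p. p \<in> P \<Longrightarrow> prime p \<and> p > 2" "e = 1 \<or> e = 2"
  shows "(\<Prod>p\<in>P. Legendre (- int e) (int p)) =
           chi4 (\<Prod>p\<in>P. p) * (if e = 2 then chi8 (\<Prod>p\<in>P. p) else 1)"
proof -
  have "chi4 (\<Prod>p\<in>P. p) = (\<Prod>p\<in>P. chi4 p)" "chi8 (\<Prod>p\<in>P. p) = (\<Prod>p\<in>P. chi8 p)"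
    by (intro multiplicative_prod chi4_mult chi8_mult; simp add: chi4_def chi8_def)+
  then show ?thesis
    using assms
    by (auto simp: Legendre_minus_one Legendre_minus_two prod.distrib intro!: prod.cong)
qed

lemma squarefree_eq_odd_prime_factors:
  assumes "squarefree (N :: nat)"
  shows "N = (if even N then 2 else 1) * (\<Prod>p\<in>prime_factors N - {2}. p)"
proof (cases "even N")
  case True
  then have "2 \<in> prime_factors N"
    using assms by (cases "N = 0") (auto simp: in_prime_factors_iff)
  then show ?thesis
    using squarefree_eq_prod_prime_factors [OF assms] True
    by (simp add: prod.remove [of "prime_factors N" 2])
next
  case False
  then have "prime_factors N - {2} = prime_factors N" by (auto simp: in_prime_factors_iff)
  then show ?thesis using squarefree_eq_prod_prime_factors [OF assms] False by simp
qed

lemma chi_sign_condition_solvable: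
  fixes N M :: nat
  assumes "odd M" "N = (if even N then 2 else 1) * M" "N mod 8 \<in> {1, 2, 3, 5, 6}"
  obtains e s where "e = 1 \<or> e = 2 \<and> odd N" "s = 1 \<or> s = (5 :: nat)"
    "(if even N then chi8 s else 1) * (chi4 M * (if e = (2 :: nat) then chi8 M else 1)) = 1"
proof -
  consider "M mod 4 = 1" | "even N" "M mod 4 = 3" | "odd N" "M mod 8 = 3"
  proof (cases "even N")
    case True
    have "M mod 4 = 1 \<or> M mod 4 = 3" using \<open>odd M\<close> by presburger
    then show ?thesis using that True by blast
  next
    case False
    then have "M mod 8 = 1 \<or> M mod 8 = 3 \<or> M mod 8 = 5"
      using assms by (simp split: if_splits) presburger
    then have "M mod 4 = 1 \<or> M mod 8 = 3" using mod_4_eq_mod_8_mod_4 [of M] by auto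
    then show ?thesis using that False by blast
  qed
  then show ?thesis
  proof cases
    case 1
    then show ?thesis by (intro that [of 1 1]) (auto simp: chi4_def chi8_def)
  next
    case 2
    then show ?thesis by (intro that [of 1 5]) (auto simp: chi4_def chi8_def)
  next
    case 3
    moreover from this have "M mod 4 = 3" using mod_4_eq_mod_8_mod_4 [of M] by simp
    ultimately show ?thesis by (intro that [of 2 1]) (auto simp: chi4_def chi8_def)
  qed
qed

lemma sum_of_three_squares_squarefree:
  assumes N_conditions: "squarefree N" "N mod 8 \<in> {1, 2, 3, 5, 6 :: nat}"
  shows "sum_of_three_squares (int N)"
proof -
  define P where "P = prime_factors N - {2}"
  have odd_primes: "finite P" "\<And>p. p \<in> P \<Longrightarrow> prime p \<and> p > 2"
    using prime_ge_2_nat by (auto simp: P_def in_prime_factors_iff le_less)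
  define M where "M = (\<Prod>p\<in>P. p)"
  have "odd M" unfolding M_def using odd_primes by (auto simp: even_prod_iff prime_odd_nat)
  have N_eq: "N = (if even N then 2 else 1) * M"
    unfolding M_def P_def using N_conditions(1) by (rule squarefree_eq_odd_prime_factors)
  obtain e s where e_cases: "e = 1 \<or> e = 2 \<and> odd N" and s_cases: "s = 1 \<or> s = (5 :: nat)"
    and signs: "(if even N then chi8 s else 1) *
      (chi4 M * (if e = (2 :: nat) then chi8 M else 1)) = 1"
    using \<open>odd M\<close> N_eq N_conditions(2) by (rule chi_sign_condition_solvable)
  have "Legendre (- int e) (int p) \<in> {-1, 1}" if "p \<in> P" for p
    using odd_primes(2) [OF that] e_cases Legendre_cases [of "- int e" "int p"]
    by (auto simp: Legendre_eq_0_iff dest!: dvd_imp_le)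
  then obtain q where q_values: "q > N" "prime q" "[q = s] (mod 8)"
      "\<And>p. p \<in> P \<Longrightarrow> Legendre (int q) (int p) = Legendre (- int e) (int p)"
    using prime_cong_8_with_Legendre_values [of P "\<lambda>p. Legendre (- int e) (int p)" s N]
      odd_primes s_cases
    by auto
  have q_mod_8: "q mod 8 = s" using q_values(3) s_cases by (auto simp: cong_def)
  then have q_mod_4: "q mod 4 = 1" using s_cases mod_4_eq_mod_8_mod_4 [of q] by auto
  have q_gt_2: "q > 2" using q_values(2) q_mod_4 by (rule prime_gt_2_if_cong_1_mod_4)
  have "q \<notin> P" using q_values(1) by (auto simp: P_def in_prime_factors_iff dest: dvd_imp_le)
  then have "Legendre (int M) (int q) = (\<Prod>p\<in>P. Legendre (int q) (int p))"
    unfolding M_def using odd_primes q_values(2) q_mod_4 by (intro Legendre_prod_commute) auto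
  also have "\<dots> = chi4 M * (if e = 2 then chi8 M else 1)"
    using prod_Legendre_minus [of P e] odd_primes(2) q_values(4) e_cases unfolding M_def by auto
  finally have "Legendre (int M) (int q) = \<dots>" .
  moreover have "Legendre 2 (int q) = chi8 s"
    using Legendre_two [OF q_values(2) q_gt_2] q_mod_8 by (simp add: chi8_def)
  ultimately have "Legendre (int N) (int q) = 1"
    using signs Legendre_mult [OF q_values(2) q_gt_2, of 2 "int M"] N_eq
    by (simp split: if_splits)
  then show ?thesis
    using q_values q_mod_4 N_conditions(1) e_cases
    by (intro sum_of_three_squares_if_Legendre [of N e q]) (auto simp: P_def)
qed

theorem sum_of_three_squares_nat:
  assumes N_mod_8: "N mod 8 \<in> {1, 2, 3, 5, 6 :: nat}"
  shows "sum_of_three_squares (int N)"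
proof -
  define m k where "m = squarefree_part N" and "k = square_part N"
  have N_eq: "N = m * k\<^sup>2" unfolding m_def k_def by (rule squarefree_decompose)
  have "odd k"
  proof
    assume "even k"
    then have "4 dvd N" by (auto simp: N_eq power_mult_distrib elim!: evenE)
    then show False using N_mod_8 mod_4_eq_mod_8_mod_4 [of N] by auto
  qed
  then have "k\<^sup>2 mod 8 = 1"
  proof -
    have "k mod 8 \<in> {1, 3, 5, 7}" using \<open>odd k\<close> by (rule odd_mod_8_cases)
    then show ?thesis using power_mod [of k 8 2] by auto
  qed
  then have "N mod 8 = m mod 8"
    using mod_mult_right_eq [of m "k\<^sup>2" 8] by (simp add: N_eq)
  then obtain a b c where "int m = a\<^sup>2 + b\<^sup>2 + c\<^sup>2"
    using sum_of_three_squares_squarefree [of m] N_mod_8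
    by (auto simp: m_def sum_of_three_squares_def)
  then have "int N = (a * int k)\<^sup>2 + (b * int k)\<^sup>2 + (c * int k)\<^sup>2"
    by (simp add: N_eq power_mult_distrib algebra_simps)
  then show ?thesis unfolding sum_of_three_squares_def by blast
qed

section \<open>Mixed sums of squares and triangular numbers\<close>

lemma eisenstein_norm_eq:
  fixes u v :: int
  shows "\<exists>c d. u\<^sup>2 + u * v + v\<^sup>2 = c\<^sup>2 + 3 * d\<^sup>2"
proof -
  consider k where "u = 2 * k" | k where "v = 2 * k" | k where "v = 2 * k - u"
    by (metis add_diff_cancel_left' evenE odd_even_add)
  then show ?thesis
  proof cases
    case (1 k)
    then have "u\<^sup>2 + u * v + v\<^sup>2 = (v + k)\<^sup>2 + 3 * k\<^sup>2"
      by (simp add: power2_eq_square algebra_simps)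
    then show ?thesis by blast
  next
    case (2 k)
    then have "u\<^sup>2 + u * v + v\<^sup>2 = (u + k)\<^sup>2 + 3 * k\<^sup>2"
      by (simp add: power2_eq_square algebra_simps)
    then show ?thesis by blast
  next
    case (3 k)
    have "u\<^sup>2 + u * v + v\<^sup>2 = (u - k)\<^sup>2 + 3 * k\<^sup>2"
      unfolding 3 by (simp add: power2_eq_square algebra_simps)
    then show ?thesis by blast
  qed
qed

lemma square_root_mod_3:
  fixes x :: int
  shows "\<exists>y. y\<^sup>2 = x\<^sup>2 \<and> y mod 3 = x\<^sup>2 mod 3 \<and> x\<^sup>2 mod 3 \<in> {0, 1}"
proof -
  have square: "x\<^sup>2 mod 3 = (x mod 3)\<^sup>2 mod 3" by (simp add: power_mod)
  consider "x mod 3 = 0" | "x mod 3 = 1" | "x mod 3 = 2" "(- x) mod 3 = 1"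
    by atomize_elim presburger
  then show ?thesis
  proof cases
    case 3
    then show ?thesis using square by (intro exI [of _ "- x"]) simp
  qed (use square in auto)
qed

text \<open>The lattice of all (X, Y, Z) with X = Y = Z (mod 3), scaled by 1/3, carries the form
  x^2 + 2 (u^2 + u v + v^2), where 3 x = X + Y + Z, 3 u = X - Y and 3 v = Y - Z.\<close>
lemma form_1_2_6_if_sum_of_three_squares:
  assumes "sum_of_three_squares (3 * m)"
  shows "\<exists>x y z. m = x\<^sup>2 + 2 * y\<^sup>2 + 6 * z\<^sup>2"
proof -
  obtain X Y Z where XYZ: "3 * m = X\<^sup>2 + Y\<^sup>2 + Z\<^sup>2"
    using assms by (auto simp: sum_of_three_squares_def)
  obtain A B C
    where squares: "A\<^sup>2 = X\<^sup>2" "B\<^sup>2 = Y\<^sup>2" "C\<^sup>2 = Z\<^sup>2"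
      and mod_3: "A mod 3 = X\<^sup>2 mod 3" "B mod 3 = Y\<^sup>2 mod 3" "C mod 3 = Z\<^sup>2 mod 3"
      and residues: "X\<^sup>2 mod 3 \<in> {0, 1}" "Y\<^sup>2 mod 3 \<in> {0, 1}" "Z\<^sup>2 mod 3 \<in> {0, 1}"
    using square_root_mod_3 by metis
  have "[A mod 3 + B mod 3 + C mod 3 = X\<^sup>2 + Y\<^sup>2 + Z\<^sup>2] (mod 3)"
    unfolding mod_3 by (intro cong_add) simp_all
  then have sum_mod_3: "(A mod 3 + B mod 3 + C mod 3) mod 3 = 0"
    unfolding XYZ [symmetric] by (simp only: cong_def mod_mult_self1_is_0)
  have "a = b \<and> b = c" if "(a + b + c) mod 3 = 0" "a \<in> {0, 1}" "b \<in> {0, 1}" "c \<in> {0, 1}"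
    for a b c :: int
    using that by auto
  from this [OF sum_mod_3] have "A mod 3 = B mod 3 \<and> B mod 3 = C mod 3"
    using residues unfolding mod_3 by blast
  then obtain u v where "A - B = 3 * u" "B - C = 3 * v"
    by (auto simp: mod_eq_dvd_iff elim!: dvdE)
  then have "B = C + 3 * v" "A = C + 3 * v + 3 * u" by simp_all
  then have "m = (C + 2 * v + u)\<^sup>2 + 2 * (u\<^sup>2 + u * v + v\<^sup>2)"
    using XYZ [folded squares] by (simp add: power2_eq_square algebra_simps)
  moreover obtain c d where "u\<^sup>2 + u * v + v\<^sup>2 = c\<^sup>2 + 3 * d\<^sup>2" using eisenstein_norm_eq by blast
  ultimately have "m = (C + 2 * v + u)\<^sup>2 + 2 * c\<^sup>2 + 6 * d\<^sup>2" by simp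
  then show ?thesis by blast
qed

lemma form_1_2_6:
  assumes "m mod 8 \<in> {1, 2, 3, 6, 7 :: nat}"
  shows "\<exists>x y z. int m = x\<^sup>2 + 2 * y\<^sup>2 + 6 * z\<^sup>2"
proof -
  have "3 * m mod 8 = 3 * (m mod 8) mod 8" by (simp add: mod_mult_right_eq)
  then have "3 * m mod 8 \<in> {1, 2, 3, 5, 6}" using assms by auto
  then have "sum_of_three_squares (int (3 * m))" by (rule sum_of_three_squares_nat)
  then show ?thesis by (intro form_1_2_6_if_sum_of_three_squares) simp
qed

lemma odd_square_eq_tri:
  assumes "odd x" shows "\<exists>z. x\<^sup>2 = 8 * tri z + 1"
proof -
  obtain z where "x = 2 * z + 1" using assms by (elim oddE)
  moreover have "2 * tri z = z * (z + 1)" by (simp add: tri_def)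
  ultimately have "x\<^sup>2 = 8 * tri z + 1" by (simp add: power2_eq_square algebra_simps)
  then show ?thesis ..
qed

lemma square_mod_4: "y\<^sup>2 mod 4 = (if even y then 0 else 1)" for y :: int
proof (cases "even y")
  case True
  then show ?thesis by (auto elim!: evenE simp: power_mult_distrib)
next
  case False
  then obtain t where "y\<^sup>2 = 8 * tri t + 1" using odd_square_eq_tri by blast
  then show ?thesis using False by presburger
qed

lemma square_plus_3_square_mod_4:
  fixes y z :: int
  shows "(y\<^sup>2 + 3 * z\<^sup>2) mod 4 = (if even y = even z then 0 else if even z then 1 else 3)"
proof -
  have "[y\<^sup>2 mod 4 + 3 * (z\<^sup>2 mod 4) = y\<^sup>2 + 3 * z\<^sup>2] (mod 4)"
    by (intro cong_add cong_scalar_left) simp_all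
  then show ?thesis by (simp add: square_mod_4 cong_def split: if_splits)
qed

lemma tri_plus_quarter_form:
  assumes "r \<in> {0, 1, 3}"
  shows "\<exists>t y z. y\<^sup>2 + 3 * z\<^sup>2 = 4 * (int n - tri t) + int r"
proof -
  have "2 * r + 1 < 8" using assms by auto
  then have "(2 * r + 1 + 8 * n) mod 8 = 2 * r + 1" by (simp only: mod_mult_self2 mod_less)
  then have "(2 * r + 1 + 8 * n) mod 8 \<in> {1, 2, 3, 6, 7}" using assms by auto
  then obtain x y z where "int (2 * r + 1 + 8 * n) = x\<^sup>2 + 2 * y\<^sup>2 + 6 * z\<^sup>2"
    using form_1_2_6 by blast
  then have x_square: "x\<^sup>2 = 2 * (4 * int n + int r - y\<^sup>2 - 3 * z\<^sup>2) + 1" by simp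
  then have "odd (x\<^sup>2)" by simp
  then obtain t where "x\<^sup>2 = 8 * tri t + 1" using odd_square_eq_tri [of x] by auto
  then have "y\<^sup>2 + 3 * z\<^sup>2 = 4 * (int n - tri t) + int r" using x_square by simp
  then show ?thesis by blast
qed

lemma square_plus_3_square_plus_tri: "\<exists>x y z. int n = x\<^sup>2 + 3 * y\<^sup>2 + tri z"
proof -
  obtain t y z where quarter_form: "y\<^sup>2 + 3 * z\<^sup>2 = 4 * (int n - tri t)"
    using tri_plus_quarter_form [of 0 n] by auto
  then have "even (y - z)"
    using square_plus_3_square_mod_4 [of y z] by (simp split: if_splits)
  then obtain u where y_eq: "y = z + 2 * u" by (metis evenE add.commute diff_add_cancel)
  have "int n - tri t = u\<^sup>2 + u * z + z\<^sup>2"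
    using quarter_form unfolding y_eq by (simp add: power2_eq_square algebra_simps)
  moreover obtain c d where "u\<^sup>2 + u * z + z\<^sup>2 = c\<^sup>2 + 3 * d\<^sup>2" using eisenstein_norm_eq by blast
  ultimately have "int n = c\<^sup>2 + 3 * d\<^sup>2 + tri t" by simp
  then show ?thesis by blast
qed

lemma square_plus_3_tri_plus_tri: "\<exists>x y z. int n = x\<^sup>2 + 3 * tri y + tri z"
proof -
  have "(4 * n + 2) mod 8 = 2 \<or> (4 * n + 2) mod 8 = 6" by presburger
  then obtain x y z where "int (4 * n + 2) = x\<^sup>2 + 2 * y\<^sup>2 + 6 * z\<^sup>2"
    using form_1_2_6 [of "4 * n + 2"] by auto
  then have x_square: "x\<^sup>2 = 2 * (2 * int n + 1 - y\<^sup>2 - 3 * z\<^sup>2)" by simp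
  then have "even (x\<^sup>2)" by simp
  then obtain w where x_eq: "x = 2 * w" by (auto elim: evenE)
  have odd_form: "y\<^sup>2 + 3 * z\<^sup>2 = 2 * (int n - w\<^sup>2) + 1"
    using x_square by (simp add: x_eq power_mult_distrib)
  have "odd (y\<^sup>2 + 3 * z\<^sup>2)" unfolding odd_form by simp
  then have "odd (y + 3 * z)" "odd (y - z)" by auto
  then obtain a b where odd_squares: "(y + 3 * z)\<^sup>2 = 8 * tri a + 1" "(y - z)\<^sup>2 = 8 * tri b + 1"
    using odd_square_eq_tri by blast
  have "(y + 3 * z)\<^sup>2 + 3 * (y - z)\<^sup>2 = 4 * (y\<^sup>2 + 3 * z\<^sup>2)"
    by (simp add: power2_eq_square algebra_simps)
  then have "int n = w\<^sup>2 + 3 * tri b + tri a" using odd_form unfolding odd_squares by simp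
  then show ?thesis by blast
qed

lemma square_plus_6_tri_plus_tri: "\<exists>x y z. int n = x\<^sup>2 + 6 * tri y + tri z"
proof -
  obtain t y z where quarter_form: "y\<^sup>2 + 3 * z\<^sup>2 = 4 * (int n - tri t) + 3"
    using tri_plus_quarter_form [of 3 n] by auto
  then have "(y\<^sup>2 + 3 * z\<^sup>2) mod 4 = 3" by (simp only: mod_mult_self4) simp
  then have "even y" "odd z"
    using square_plus_3_square_mod_4 [of y z] by (simp_all split: if_splits)
  then obtain w s where "y = 2 * w" "z\<^sup>2 = 8 * tri s + 1"
    using odd_square_eq_tri by (blast elim: evenE)
  then have "int n = w\<^sup>2 + 6 * tri s + tri t" using quarter_form by (simp add: power_mult_distrib)
  then show ?thesis by blast
qed

lemma three_square_plus_2_tri_plus_tri: "\<exists>x y z. int n = 3 * x\<^sup>2 + 2 * tri y + tri z"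
proof -
  obtain t y z where quarter_form: "y\<^sup>2 + 3 * z\<^sup>2 = 4 * (int n - tri t) + 1"
    using tri_plus_quarter_form [of 1 n] by auto
  then have "(y\<^sup>2 + 3 * z\<^sup>2) mod 4 = 1" by (simp only: mod_mult_self4) simp
  then have "odd y" "even z"
    using square_plus_3_square_mod_4 [of y z] by (simp_all split: if_splits)
  then obtain w s where "z = 2 * w" "y\<^sup>2 = 8 * tri s + 1"
    using odd_square_eq_tri by (blast elim: evenE)
  then have "int n = 3 * w\<^sup>2 + 2 * tri s + tri t"
    using quarter_form by (simp add: power_mult_distrib)
  then show ?thesis by blast
qed

lemma square_root_mod_8:
  fixes x :: int
  assumes "odd x" shows "\<exists>y. y\<^sup>2 = x\<^sup>2 \<and> y mod 8 \<in> {1, 3}"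
proof -
  consider "x mod 8 = 1 \<or> x mod 8 = 3" | "x mod 8 = 5 \<or> x mod 8 = 7"
    using assms by atomize_elim presburger
  then show ?thesis
  proof cases
    case 1
    then show ?thesis by blast
  next
    case 2
    then have "(- x) mod 8 \<in> {1, 3}" using mod_minus_eq [of x 8] by auto
    then show ?thesis by (intro exI [of _ "- x"]) simp
  qed
qed

lemma four_square_plus_2_tri_plus_tri_if_cong:
  assumes "8 * m + 3 = a\<^sup>2 + b\<^sup>2 + c\<^sup>2" "odd a" "odd c" "a mod 8 = b mod 8"
  shows "\<exists>x y z. m = 4 * x\<^sup>2 + 2 * tri y + tri z"
proof -
  obtain x where a_eq: "a = b + 8 * x"
    using assms(4) by (metis mod_eq_dvd_iff dvdE diff_add_cancel add.commute)
  then have "odd (b + 4 * x)" using assms(2) by simp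
  then obtain s t where "(b + 4 * x)\<^sup>2 = 8 * tri s + 1" "c\<^sup>2 = 8 * tri t + 1"
    using odd_square_eq_tri assms(3) by blast
  moreover have "a\<^sup>2 + b\<^sup>2 = 2 * (b + 4 * x)\<^sup>2 + 32 * x\<^sup>2"
    by (simp add: a_eq power2_eq_square algebra_simps)
  ultimately have "m = 4 * x\<^sup>2 + 2 * tri s + tri t" using assms(1) by simp
  then show ?thesis by blast
qed

lemma odd_if_sum_of_three_squares_3_mod_8:
  fixes a b c k :: int
  assumes "8 * k + 3 = a\<^sup>2 + b\<^sup>2 + c\<^sup>2" shows "odd a \<and> odd b \<and> odd c"
proof -
  have "[a\<^sup>2 mod 4 + b\<^sup>2 mod 4 + c\<^sup>2 mod 4 = 8 * k + 3] (mod 4)"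
    unfolding assms by (intro cong_add) simp_all
  also have "[8 * k + 3 = 3] (mod 4)" by (simp add: cong_iff_dvd_diff)
  finally show ?thesis by (simp add: square_mod_4 cong_def split: if_splits)
qed

lemma four_square_plus_2_tri_plus_tri: "\<exists>x y z. int n = 4 * x\<^sup>2 + 2 * tri y + tri z"
proof -
  have "sum_of_three_squares (int (8 * n + 3))"
    by (rule sum_of_three_squares_nat) simp
  then obtain u v w where uvw: "8 * int n + 3 = u\<^sup>2 + v\<^sup>2 + w\<^sup>2"
    by (auto simp: sum_of_three_squares_def)
  then have "odd u" "odd v" "odd w" using odd_if_sum_of_three_squares_3_mod_8 by blast+
  then obtain a b c where "a\<^sup>2 = u\<^sup>2" "b\<^sup>2 = v\<^sup>2" "c\<^sup>2 = w\<^sup>2"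
    and mod_8: "a mod 8 \<in> {1, 3}" "b mod 8 \<in> {1, 3}" "c mod 8 \<in> {1, 3}"
    using square_root_mod_8 by metis
  then have abc: "8 * int n + 3 = a\<^sup>2 + b\<^sup>2 + c\<^sup>2" using uvw by simp
  then have odd: "odd a" "odd b" "odd c" using odd_if_sum_of_three_squares_3_mod_8 by blast+
  consider "a mod 8 = b mod 8" | "b mod 8 = c mod 8" | "a mod 8 = c mod 8"
    using mod_8 by (metis insertE singletonD)
  then show ?thesis
  proof cases
    case 1
    then show ?thesis
      using abc odd by (intro four_square_plus_2_tri_plus_tri_if_cong [of _ a b c])
  next
    case 2
    then show ?thesis
      using abc odd by (intro four_square_plus_2_tri_plus_tri_if_cong [of _ b c a]) auto
  next
    case 3
    then show ?thesis
      using abc odd by (intro four_square_plus_2_tri_plus_tri_if_cong [of _ a c b]) auto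
  qed
qed

theorem theorem2:
  fixes n :: nat
  shows "(\<exists>x y z :: int. int n = x^2 + 3 * y^2 + tri z)
       \<and> (\<exists>x y z :: int. int n = x^2 + 3 * tri y + tri z)
       \<and> (\<exists>x y z :: int. int n = x^2 + 6 * tri y + tri z)
       \<and> (\<exists>x y z :: int. int n = 3 * x^2 + 2 * tri y + tri z)
       \<and> (\<exists>x y z :: int. int n = 4 * x^2 + 2 * tri y + tri z)"
  by (intro conjI square_plus_3_square_plus_tri square_plus_3_tri_plus_tri
      square_plus_6_tri_plus_tri three_square_plus_2_tri_plus_tri four_square_plus_2_tri_plus_tri)

end
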